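(* Let $\Gamma:J^1\pi\to J^2\pi$ be a second order connection, let $(\varphi,v)$ be a pair consisting of a non-vanishing closed $1$-form $\varphi$ and a vector field $v$ on $X$ with $i_v\varphi=1$, and let $Z:V\to J^1\pi$ ($V\subset Y$ open) be a local connection embedded in $\Gamma$. Let $Z_v=v^iZ_i$ be the $D_Z$-lift of $v$ to $V$. Then the directional shape operator $A_Z=Z^\varphi\mathcal{Q}_+$ satisfies $$\mathcal{L}_{Z_v}A_Z=-(A_Z)^2-i_{Z_v}\bigl(Z^\varphi\Phi_++Z^\varphi r_+\bigr),$$ where $(A_Z)^2=A_Z\circ A_Z$ is the composition of endomorphisms of $TV$.
   Context: All objects are smooth; summation convention over repeated indices is used. $\pi:Y\to X$ is a fibred manifold with $\dim X=n>1$, $\dim Y=n+m$; $\pi_1:J^1\pi\to X$, $\pi_{1,0}:J^1\pi\to Y$, $J^2\pi$ are the jet bundles, with fibred coordinates $(x^i,y^\sigma)$, $(x^i,y^\sigma,y^\sigma_j)$, $(x^i,y^\sigma,y^\sigma_j,y^\sigma_{jk})$. $V\pi$, $V\pi_{1,0}$ are the vertical bundles of $\pi$, $\pi_{1,0}$. $\omega^\sigma=dy^\sigma-y^\sigma_jdx^j$. Second order connection: a section $\Gamma:J^1\pi\to J^2\pi$ of $J^2\pi\to J^1\pi$, with components $F^\sigma_{ij}=y^\sigma_{ij}\circ\Gamma=F^\sigma_{ji}$. Put $\Gamma_i=\frac{\partial}{\partial x^i}+y^\sigma_i\frac{\partial}{\partial y^\sigma}+F^\sigma_{ij}\frac{\partial}{\partial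 y^\sigma_j}$, $D_\Gamma=\mathrm{span}\{\Gamma_i\}$, $\mathcal{G}=dx^i\otimes\Gamma_i$. Data on $X$: $\varphi=\varphi_idx^i$ closed non-vanishing, $v=v^i\partial/\partial x^i$, $i_v\varphi=1$. $S^\varphi=\varphi_i\,\omega^\sigma\otimes\frac{\partial}{\partial y^\sigma_i}$, $\Gamma_v=v^i\Gamma_i$. The endomorphism $\mathcal{L}_{\Gamma_v}S^\varphi$ of $TJ^1\pi$ has eigenvalues $0,1,-1$ with eigendistributions $\mathcal{D}_0$, $\mathcal{D}_+=\mathrm{span}\{\varphi_i\partial/\partial y^\sigma_i\}$ and $H=\mathrm{span}\{H_\sigma=\frac{\partial}{\partial y^\sigma}+H^\nu_{\sigma k}\frac{\partial}{\partial y^\nu_k}\}$ (the last formula defines $H^\nu_{\sigma k}$), and $TJ^1\pi=D_\Gamma\oplus H\oplus(\mathcal{D}_0\cap V\pi_{1,0})\oplus\mathcal{D}_+$. Write $\mathcal{G},\mathcal{P},\tilde{\mathcal{Q}},\mathcal{Q}_+$ for the corresponding four projectors, regarded as vector-valued $1$-forms on $J^1\pi$. With $\psi^\nu_k=dy^\nu_k-F^\nu_{ki}dx^i-H^\nu_{\sigma k}\omega^\sigma$ one has $\mathcal{P}=\omega^\sigma\otimes H_\sigma$. Adapted coordinates: coordinates with $\varphi=dx^1$, $v^1=1$; indices $p,q$ run over $2,\dots,n$. Then $H^\nu_{\sigma1}=\frac12\bigl(\frac{\partial F^\nu_{11}}{\partial y^\sigma_1}-v^pv^q\frac{\partial F^\nu_{pq}}{\partial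 y^\sigma_1}\bigr)$, $H^\nu_{\sigma p}=v^k\frac{\partial F^\nu_{pk}}{\partial y^\sigma_1}$, $\mathcal{D}_+=\mathrm{span}\{\partial/\partial y^\sigma_1\}$, $\mathcal{Q}_+=v^k\psi^\sigma_k\otimes\frac{\partial}{\partial y^\sigma_1}$, $\tilde{\mathcal{Q}}=\psi^\nu_p\otimes W^p_\nu$ with $W^p_\nu=\frac{\partial}{\partial y^\nu_p}-v^p\frac{\partial}{\partial y^\nu_1}$. $[\![\cdot,\cdot]\!]$ is the Frölicher–Nijenhuis bracket of vector-valued forms: $[\![\omega\otimes\xi,\eta\otimes\zeta]\!]=\omega\wedge\eta\otimes[\xi,\zeta]+\omega\wedge\mathcal{L}_\xi\eta\otimes\zeta-\mathcal{L}_\zeta\omega\wedge\eta\otimes\xi+(-1)^{\deg\omega}(d\omega\wedge i_\xi\eta\otimes\zeta+i_\zeta\omega\wedge d\eta\otimes\xi)$. For a vector field $\xi$, $\mathcal{L}_\xi K=[\![\xi,K]\!]$. Curvatures: $\Phi_+=\mathcal{Q}_+\circ[\![\mathcal{G},\mathcal{P}]\!]$, in adapted coordinates $\Phi_+=v^k\bigl(\Gamma_i(H^\sigma_{\nu k})-H_\nu(F^\sigma_{ik})+H^\rho_{\nu i}H^\sigma_{\rho k}\bigr)dx^i\wedge\omega^\nu\otimes\frac{\partial}{\partial y^\sigma_1}$; and $r_+=\mathcal{Q}_+\circ[\![\mathcal{G},\tilde{\mathcal{Q}}]\!]$, in adapted coordinates $r_+=dx^i\wedge\psi^\nu_p\otimes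 v^k\bigl(v^p\frac{\partial F^\sigma_{ik}}{\partial y^\nu_1}-\frac{\partial F^\sigma_{ik}}{\partial y^\nu_p}-(v^p\delta^1_i-\delta^p_i)H^\sigma_{\nu k}\bigr)\frac{\partial}{\partial y^\sigma_1}-dx^i\wedge\psi^\nu_p\otimes\frac{\partial v^p}{\partial x^i}\frac{\partial}{\partial y^\nu_1}$. Embedded connection: a local connection is a local section $Z:V\to J^1\pi$ of $\pi_{1,0}$, with components $Z^\sigma_i=y^\sigma_i\circ Z$, $Z_i=\frac{\partial}{\partial x^i}+Z^\sigma_i\frac{\partial}{\partial y^\sigma}$, $D_Z=\mathrm{span}\{Z_i\}$. It is embedded in $\Gamma$ if $T_yZ(D_Z(y))\subset D_\Gamma(Z(y))$ for all $y\in V$. The map $Z^\varphi$: let $s:\mathcal{D}_+\to V\pi$ be the fibrewise isomorphism with $s(\varphi_i\partial/\partial y^\sigma_i|_{p})=\partial/\partial y^\sigma|_{\pi_{1,0}(p)}$. For a $\mathcal{D}_+$-valued $q$-form $\mathcal{K}$ on $J^1\pi$, $(Z^\varphi\mathcal{K})(y)(\xi_1,\dots,\xi_q)=s_{Z(y)}\bigl(\mathcal{K}(Z(y))(TZ(\xi_1),\dots,TZ(\xi_q))\bigr)$; in adapted coordinates, if $\mathcal{K}=\eta^\sigma\otimes\partial/\partial y^\sigma_1$ then $Z^\varphi\mathcal{K}=Z^*\eta^\sigma\otimes\partial/\partial y^\sigma$. The shape operator $A_Z=Z^\varphi\mathcal{Q}_+$ is a vector-valued $1$-form on $V$. *)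

theory Defs
  imports "HOL-Analysis.Analysis"
begin

section \<open>Smooth functions on open subsets of Euclidean spaces\<close>

primrec Ck_on :: "nat \<Rightarrow> 'a::euclidean_space set \<Rightarrow> ('a \<Rightarrow> 'b::real_normed_vector) \<Rightarrow> bool" where
  "Ck_on 0 S f \<longleftrightarrow> continuous_on S f"
| "Ck_on (Suc k) S f \<longleftrightarrow>
     (\<forall>x\<in>S. f differentiable (at x)) \<and> (\<forall>u. Ck_on k S (\<lambda>x. frechet_derivative f (at x) u))"

definition smooth_on :: "'a::euclidean_space set \<Rightarrow> ('a \<Rightarrow> 'b::real_normed_vector) \<Rightarrow> bool" where
  "smooth_on S f \<longleftrightarrow> (\<forall>k. Ck_on k S f)"

definition partial :: "'n::finite \<Rightarrow> (real^'n \<Rightarrow> 'b::real_normed_vector) \<Rightarrow> real^'n \<Rightarrow> 'b" where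
  "partial i f x = frechet_derivative f (at x) (axis i 1)"

primrec partials :: "'n::finite list \<Rightarrow> (real^'n \<Rightarrow> 'b::real_normed_vector) \<Rightarrow> real^'n \<Rightarrow> 'b" where
  "partials [] f = f"
| "partials (i # l) f = partial i (partials l f)"


section \<open>Differential forms on open subsets of Euclidean spaces\<close>

text \<open>
  A \<open>q\<close>-form takes a point and a sequence of vectors, of which it uses those with
  index \<open>0, \<dots>, q - 1\<close>. The degree is passed explicitly to the operations that depend on it.
  Vector fields, regarded as vector-valued \<open>0\<close>-forms, are of the form \<open>\<lambda>x _. \<xi> x\<close>.
\<close>

type_synonym 'e form = "'e \<Rightarrow> (nat \<Rightarrow> 'e) \<Rightarrow> real"
type_synonym 'e vform = "'e \<Rightarrow> (nat \<Rightarrow> 'e) \<Rightarrow> 'e"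

definition wedge :: "nat \<Rightarrow> nat \<Rightarrow> 'e form \<Rightarrow> 'e form \<Rightarrow> 'e form" where
  "wedge p q \<alpha> \<beta> x w =
     (\<Sum>s | s permutes {..<p+q}. of_int (sign s) * \<alpha> x (\<lambda>k. w (s k)) * \<beta> x (\<lambda>k. w (s (p + k))))
       / (fact p * fact q)"

definition ext_d :: "nat \<Rightarrow> 'e::euclidean_space form \<Rightarrow> 'e form" where
  "ext_d q \<alpha> x w =
     (\<Sum>i\<le>q. (-1)^i *
        frechet_derivative (\<lambda>x'. \<alpha> x' (\<lambda>k. w (if k < i then k else Suc k))) (at x) (w i))"

definition contract :: "nat \<Rightarrow> ('e \<Rightarrow> 'e) \<Rightarrow> 'e form \<Rightarrow> 'e form" where
  "contract q \<xi> \<alpha> x w = (if q = 0 then 0 else \<alpha> x (case_nat (\<xi> x) w))"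

definition lie_form :: "nat \<Rightarrow> ('e \<Rightarrow> 'e) \<Rightarrow> 'e::euclidean_space form \<Rightarrow> 'e form" where
  "lie_form q \<xi> \<alpha> x w =
     contract (q + 1) \<xi> (ext_d q \<alpha>) x w + ext_d (q - 1) (contract q \<xi> \<alpha>) x w"

definition lie_bracket :: "('e \<Rightarrow> 'e) \<Rightarrow> ('e \<Rightarrow> 'e) \<Rightarrow> 'e::euclidean_space \<Rightarrow> 'e" where
  "lie_bracket \<xi> \<zeta> x = frechet_derivative \<zeta> (at x) (\<xi> x) - frechet_derivative \<xi> (at x) (\<zeta> x)"

text \<open>
  The Froelicher--Nijenhuis bracket of \<open>\<omega> \<otimes> \<xi>\<close> and \<open>\<eta> \<otimes> \<zeta>\<close>, extended biadditively to
  \<open>K = \<Sum>a. K\<^sup>a \<otimes> \<partial>\<^sub>a\<close> and \<open>L = \<Sum>b. L\<^sup>b \<otimes> \<partial>\<^sub>b\<close>. Where \<open>p - 1\<close> or \<open>q - 1\<close> is truncated, the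
  corresponding contraction is zero.
\<close>

definition fn_decomposable ::
  "nat \<Rightarrow> nat \<Rightarrow> 'e form \<Rightarrow> ('e \<Rightarrow> 'e) \<Rightarrow> 'e form \<Rightarrow> ('e \<Rightarrow> 'e) \<Rightarrow> 'e::euclidean_space vform" where
  "fn_decomposable p q \<omega> \<xi> \<eta> \<zeta> x w =
     wedge p q \<omega> \<eta> x w *\<^sub>R lie_bracket \<xi> \<zeta> x
     + wedge p q \<omega> (lie_form q \<xi> \<eta>) x w *\<^sub>R \<zeta> x
     - wedge p q (lie_form p \<zeta> \<omega>) \<eta> x w *\<^sub>R \<xi> x
     + (-1)^p *\<^sub>R (wedge (p + 1) (q - 1) (ext_d p \<omega>) (contract q \<xi> \<eta>) x w *\<^sub>R \<zeta> x
                 + wedge (p - 1) (q + 1) (contract p \<zeta> \<omega>) (ext_d q \<eta>) x w *\<^sub>R \<xi> x)"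

definition fn_bracket :: "nat \<Rightarrow> nat \<Rightarrow> 'e vform \<Rightarrow> 'e vform \<Rightarrow> 'e::euclidean_space vform" where
  "fn_bracket p q K L x w =
     (\<Sum>a\<in>Basis. \<Sum>b\<in>Basis.
        fn_decomposable p q (\<lambda>x w. K x w \<bullet> a) (\<lambda>_. a) (\<lambda>x w. L x w \<bullet> b) (\<lambda>_. b) x w)"

definition lie_vform :: "nat \<Rightarrow> ('e \<Rightarrow> 'e) \<Rightarrow> 'e vform \<Rightarrow> 'e::euclidean_space vform" where
  "lie_vform q \<xi> K = fn_bracket 0 q (\<lambda>x _. \<xi> x) K"

definition contract_vform :: "('e \<Rightarrow> 'e) \<Rightarrow> 'e vform \<Rightarrow> 'e vform" where
  "contract_vform \<xi> K x w = K x (case_nat (\<xi> x) w)"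

definition comp_vform :: "'e vform \<Rightarrow> 'e vform \<Rightarrow> 'e vform" where
  "comp_vform A K x w = A x (\<lambda>_. K x w)"

definition eigenspace :: "'e vform \<Rightarrow> real \<Rightarrow> 'e \<Rightarrow> 'e::real_vector set" where
  "eigenspace E c x = {u. E x (\<lambda>_. u) = c *\<^sub>R u}"

definition projector :: "'e::real_vector set \<Rightarrow> 'e set \<Rightarrow> 'e \<Rightarrow> 'e" where
  "projector A B u = (THE a. a \<in> A \<and> u - a \<in> B)"


section \<open>Smooth manifolds\<close>

text \<open>A chart is a pair of a domain and a coordinate map; only the values on the domain matter.\<close>

type_synonym ('p, 'e) chart = "'p set \<times> ('p \<Rightarrow> 'e)"

record ('p, 'e) manifold =
  mtop :: "'p topology"
  charts :: "('p, 'e) chart set"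

definition image_of :: "('p, 'e) chart \<Rightarrow> 'e set" where
  "image_of c = snd c ` fst c"

definition inv_chart :: "('p, 'e) chart \<Rightarrow> 'e \<Rightarrow> 'p" where
  "inv_chart c = inv_into (fst c) (snd c)"

definition coord_rep :: "('p, 'e) chart \<Rightarrow> ('q, 'f) chart \<Rightarrow> ('p \<Rightarrow> 'q) \<Rightarrow> 'e \<Rightarrow> 'f" where
  "coord_rep c d f \<xi> = snd d (f (inv_chart c \<xi>))"

definition is_chart :: "'p topology \<Rightarrow> ('p, 'e::euclidean_space) chart \<Rightarrow> bool" where
  "is_chart T c \<longleftrightarrow> openin T (fst c) \<and> open (image_of c) \<and>
     homeomorphic_map (subtopology T (fst c)) (top_of_set (image_of c)) (snd c)"

definition compatible :: "('p, 'e::euclidean_space) chart \<Rightarrow> ('p, 'e) chart \<Rightarrow> bool" where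
  "compatible c d \<longleftrightarrow>
     smooth_on (snd c ` (fst c \<inter> fst d)) (coord_rep c d id) \<and>
     smooth_on (snd d ` (fst c \<inter> fst d)) (coord_rep d c id)"

definition smooth_manifold :: "('p, 'e::euclidean_space) manifold \<Rightarrow> bool" where
  "smooth_manifold M \<longleftrightarrow>
     Hausdorff_space (mtop M) \<and> second_countable (mtop M) \<and>
     \<Union> (fst ` charts M) = topspace (mtop M) \<and>
     (\<forall>c\<in>charts M. is_chart (mtop M) c) \<and>
     (\<forall>c\<in>charts M. \<forall>d\<in>charts M. compatible c d) \<and>
     (\<forall>c. is_chart (mtop M) c \<and> (\<forall>d\<in>charts M. compatible c d) \<longrightarrow> c \<in> charts M)"

definition smooth_map ::
  "('p, 'e::euclidean_space) manifold \<Rightarrow> ('q, 'f::euclidean_space) manifold \<Rightarrow> 'p set \<Rightarrow>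
   ('p \<Rightarrow> 'q) \<Rightarrow> bool" where
  "smooth_map M N W f \<longleftrightarrow>
     openin (mtop M) W \<and> continuous_map (subtopology (mtop M) W) (mtop N) f \<and>
     (\<forall>c\<in>charts M. \<forall>d\<in>charts N.
        smooth_on (snd c ` {x \<in> fst c \<inter> W. f x \<in> fst d}) (coord_rep c d f))"

text \<open>
  Vector fields and \<open>1\<close>-forms on a manifold are given by their components in all charts, subject
  to the tensorial transformation law. The components of a \<open>1\<close>-form are collected in a vector.
\<close>

definition vector_field ::
  "('p, 'e::euclidean_space) manifold \<Rightarrow> (('p, 'e) chart \<Rightarrow> 'e \<Rightarrow> 'e) \<Rightarrow> bool" where
  "vector_field M v \<longleftrightarrow>
     (\<forall>c\<in>charts M. smooth_on (image_of c) (v c)) \<and>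
     (\<forall>c\<in>charts M. \<forall>d\<in>charts M. \<forall>x\<in>fst c \<inter> fst d.
        v d (snd d x) = frechet_derivative (coord_rep c d id) (at (snd c x)) (v c (snd c x)))"

definition one_form ::
  "('p, 'e::euclidean_space) manifold \<Rightarrow> (('p, 'e) chart \<Rightarrow> 'e \<Rightarrow> 'e) \<Rightarrow> bool" where
  "one_form M \<phi> \<longleftrightarrow>
     (\<forall>c\<in>charts M. smooth_on (image_of c) (\<phi> c)) \<and>
     (\<forall>c\<in>charts M. \<forall>d\<in>charts M. \<forall>x\<in>fst c \<inter> fst d. \<forall>u.
        \<phi> c (snd c x) \<bullet> u =
        \<phi> d (snd d x) \<bullet> frechet_derivative (coord_rep c d id) (at (snd c x)) u)"

definition closed_form ::
  "('p, 'e::euclidean_space) manifold \<Rightarrow> (('p, 'e) chart \<Rightarrow> 'e \<Rightarrow> 'e) \<Rightarrow> bool" where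
  "closed_form M \<phi> \<longleftrightarrow>
     (\<forall>c\<in>charts M. \<forall>\<xi>\<in>image_of c. \<forall>w. ext_d 1 (\<lambda>\<xi> w. \<phi> c \<xi> \<bullet> w 0) \<xi> w = 0)"

definition nonvanishing_form ::
  "('p, 'e::euclidean_space) manifold \<Rightarrow> (('p, 'e) chart \<Rightarrow> 'e \<Rightarrow> 'e) \<Rightarrow> bool" where
  "nonvanishing_form M \<phi> \<longleftrightarrow> (\<forall>c\<in>charts M. \<forall>\<xi>\<in>image_of c. \<phi> c \<xi> \<noteq> 0)"

definition unit_pairing ::
  "('p, 'e::euclidean_space) manifold \<Rightarrow> (('p, 'e) chart \<Rightarrow> 'e \<Rightarrow> 'e) \<Rightarrow>
   (('p, 'e) chart \<Rightarrow> 'e \<Rightarrow> 'e) \<Rightarrow> bool" where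
  "unit_pairing M \<phi> v \<longleftrightarrow> (\<forall>c\<in>charts M. \<forall>\<xi>\<in>image_of c. \<phi> c \<xi> \<bullet> v c \<xi> = 1)"


section \<open>Fibred manifolds and jets\<close>

text \<open>
  Coordinates \<open>(x\<^sup>i, y\<^sup>\<sigma>)\<close> on the total space and \<open>(x\<^sup>i, y\<^sup>\<sigma>, y\<^sup>\<sigma>\<^sub>i)\<close> on the first jet
  bundle; the last entry is indexed as \<open>z $ \<sigma> $ i\<close>.
\<close>

type_synonym ('n, 'm) ycoord = "(real^'n) \<times> (real^'m)"
type_synonym ('n, 'm) jcoord = "(real^'n) \<times> (real^'m) \<times> (real^'n^'m)"

type_synonym ('x, 'n) base = "('x, real^'n) manifold"
type_synonym ('y, 'n, 'm) total = "('y, ('n, 'm) ycoord) manifold"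
type_synonym ('x, 'y, 'n, 'm) fchart = "('x, real^'n) chart \<times> ('y, ('n, 'm) ycoord) chart"

definition fibred_manifold ::
  "('x, 'n::finite) base \<Rightarrow> ('y, 'n, 'm::finite) total \<Rightarrow> ('y \<Rightarrow> 'x) \<Rightarrow> bool" where
  "fibred_manifold X Y \<pi> \<longleftrightarrow>
     smooth_manifold X \<and> smooth_manifold Y \<and>
     smooth_map Y X (topspace (mtop Y)) \<pi> \<and>
     \<pi> ` topspace (mtop Y) = topspace (mtop X) \<and>
     (\<forall>c\<in>charts Y. \<forall>b\<in>charts X. \<forall>y\<in>fst c. \<pi> y \<in> fst b \<longrightarrow>
        surj (frechet_derivative (coord_rep c b \<pi>) (at (snd c y))))"

definition fibred_charts ::
  "('x, 'n::finite) base \<Rightarrow> ('y, 'n, 'm::finite) total \<Rightarrow> ('y \<Rightarrow> 'x) \<Rightarrow>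
   ('x, 'y, 'n, 'm) fchart set" where
  "fibred_charts X Y \<pi> =
     {(b, c). b \<in> charts X \<and> c \<in> charts Y \<and> fst b = \<pi> ` fst c \<and>
              (\<forall>y\<in>fst c. fst (snd c y) = snd b (\<pi> y))}"

definition local_section ::
  "('x, 'n::finite) base \<Rightarrow> ('y, 'n, 'm::finite) total \<Rightarrow> ('y \<Rightarrow> 'x) \<Rightarrow> 'x \<Rightarrow> ('x \<Rightarrow> 'y) \<Rightarrow>
   bool" where
  "local_section X Y \<pi> x \<gamma> \<longleftrightarrow>
     (\<exists>W. x \<in> W \<and> smooth_map X Y W \<gamma> \<and> (\<forall>x'\<in>W. \<pi> (\<gamma> x') = x'))"

definition same_jet ::
  "('x, 'n::finite) base \<Rightarrow> ('y, 'n, 'm::finite) total \<Rightarrow> nat \<Rightarrow> 'x \<Rightarrow> ('x \<Rightarrow> 'y) \<Rightarrow>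
   ('x \<Rightarrow> 'y) \<Rightarrow> bool" where
  "same_jet X Y k x \<gamma> \<gamma>' \<longleftrightarrow>
     \<gamma> x = \<gamma>' x \<and>
     (\<forall>b\<in>charts X. \<forall>c\<in>charts Y. x \<in> fst b \<and> \<gamma> x \<in> fst c \<longrightarrow>
        (\<forall>l. length l \<le> k \<longrightarrow>
           partials l (coord_rep b c \<gamma>) (snd b x) = partials l (coord_rep b c \<gamma>') (snd b x)))"

text \<open>A jet is its source point together with an equivalence class of local sections.\<close>

type_synonym ('x, 'y) jet = "'x \<times> ('x \<Rightarrow> 'y) set"

definition jet ::
  "('x, 'n::finite) base \<Rightarrow> ('y, 'n, 'm::finite) total \<Rightarrow> ('y \<Rightarrow> 'x) \<Rightarrow> nat \<Rightarrow> 'x \<Rightarrow>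
   ('x \<Rightarrow> 'y) \<Rightarrow> ('x, 'y) jet" where
  "jet X Y \<pi> k x \<gamma> = (x, {\<gamma>'. local_section X Y \<pi> x \<gamma>' \<and> same_jet X Y k x \<gamma> \<gamma>'})"

definition jets ::
  "('x, 'n::finite) base \<Rightarrow> ('y, 'n, 'm::finite) total \<Rightarrow> ('y \<Rightarrow> 'x) \<Rightarrow> nat \<Rightarrow>
   ('x, 'y) jet set" where
  "jets X Y \<pi> k =
     {jet X Y \<pi> k x \<gamma> | x \<gamma>. x \<in> topspace (mtop X) \<and> local_section X Y \<pi> x \<gamma>}"

definition representative :: "('x, 'y) jet \<Rightarrow> 'x \<Rightarrow> 'y" where
  "representative j = (SOME \<gamma>. \<gamma> \<in> snd j)"

definition target :: "('x, 'y) jet \<Rightarrow> 'y" where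
  "target j = representative j (fst j)"

definition jet_proj ::
  "('x, 'n::finite) base \<Rightarrow> ('y, 'n, 'm::finite) total \<Rightarrow> ('y \<Rightarrow> 'x) \<Rightarrow> nat \<Rightarrow>
   ('x, 'y) jet \<Rightarrow> ('x, 'y) jet" where
  "jet_proj X Y \<pi> k j = jet X Y \<pi> k (fst j) (representative j)"

definition fibre_rep ::
  "('x, 'y, 'n::finite, 'm::finite) fchart \<Rightarrow> ('x, 'y) jet \<Rightarrow> real^'n \<Rightarrow> real^'m" where
  "fibre_rep C j \<xi> = snd (coord_rep (fst C) (snd C) (representative j) \<xi>)"

definition jet1_coords ::
  "('x, 'y, 'n::finite, 'm::finite) fchart \<Rightarrow> ('x, 'y) jet \<Rightarrow> ('n, 'm) jcoord" where
  "jet1_coords C j =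
     (let \<xi> = snd (fst C) (fst j)
      in (\<xi>, fibre_rep C j \<xi>, \<chi> \<sigma> i. partial i (fibre_rep C j) \<xi> $ \<sigma>))"

definition jet2_second_coords ::
  "('x, 'y, 'n::finite, 'm::finite) fchart \<Rightarrow> ('x, 'y) jet \<Rightarrow> real^'n^'n^'m" where
  "jet2_second_coords C j =
     (\<chi> \<sigma> i k. partials [i, k] (fibre_rep C j) (snd (fst C) (fst j)) $ \<sigma>)"

definition jet1_domain ::
  "('x, 'n::finite) base \<Rightarrow> ('y, 'n, 'm::finite) total \<Rightarrow> ('y \<Rightarrow> 'x) \<Rightarrow>
   ('x, 'y, 'n, 'm) fchart \<Rightarrow> ('x, 'y) jet set" where
  "jet1_domain X Y \<pi> C = {j \<in> jets X Y \<pi> 1. target j \<in> fst (snd C)}"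

definition soc_components ::
  "('x, 'n::finite) base \<Rightarrow> ('y, 'n, 'm::finite) total \<Rightarrow> ('y \<Rightarrow> 'x) \<Rightarrow>
   (('x, 'y) jet \<Rightarrow> ('x, 'y) jet) \<Rightarrow> ('x, 'y, 'n, 'm) fchart \<Rightarrow> ('n, 'm) jcoord \<Rightarrow>
   real^'n^'n^'m" where
  "soc_components X Y \<pi> \<Gamma> C p =
     jet2_second_coords C (\<Gamma> (inv_into (jet1_domain X Y \<pi> C) (jet1_coords C) p))"

definition second_order_connection ::
  "('x, 'n::finite) base \<Rightarrow> ('y, 'n, 'm::finite) total \<Rightarrow> ('y \<Rightarrow> 'x) \<Rightarrow>
   (('x, 'y) jet \<Rightarrow> ('x, 'y) jet) \<Rightarrow> bool" where
  "second_order_connection X Y \<pi> \<Gamma> \<longleftrightarrow>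
     (\<forall>j\<in>jets X Y \<pi> 1. \<Gamma> j \<in> jets X Y \<pi> 2 \<and> jet_proj X Y \<pi> 1 (\<Gamma> j) = j) \<and>
     (\<forall>C\<in>fibred_charts X Y \<pi>.
        smooth_on (jet1_coords C ` jet1_domain X Y \<pi> C) (soc_components X Y \<pi> \<Gamma> C))"

definition connection_rep ::
  "('x, 'y, 'n::finite, 'm::finite) fchart \<Rightarrow> ('y \<Rightarrow> ('x, 'y) jet) \<Rightarrow>
   ('n, 'm) ycoord \<Rightarrow> ('n, 'm) jcoord" where
  "connection_rep C Z \<eta> = jet1_coords C (Z (inv_chart (snd C) \<eta>))"

definition local_connection ::
  "('x, 'n::finite) base \<Rightarrow> ('y, 'n, 'm::finite) total \<Rightarrow> ('y \<Rightarrow> 'x) \<Rightarrow> 'y set \<Rightarrow>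
   ('y \<Rightarrow> ('x, 'y) jet) \<Rightarrow> bool" where
  "local_connection X Y \<pi> V Z \<longleftrightarrow>
     openin (mtop Y) V \<and>
     (\<forall>y\<in>V. Z y \<in> jets X Y \<pi> 1 \<and> target (Z y) = y) \<and>
     (\<forall>C\<in>fibred_charts X Y \<pi>.
        smooth_on (snd (snd C) ` (fst (snd C) \<inter> V)) (connection_rep C Z))"


section \<open>Geometry of a second order connection in a fibred chart\<close>

text \<open>
  The remaining tensor fields on the jet bundle and on the total space are described by their
  components in a fibred chart. Here \<open>F\<close> denotes the components of the second order connection,
  \<open>\<phi>\<close> and \<open>v\<close> those of the \<open>1\<close>-form and of the vector field on the base.
\<close>

definition contact :: "'m \<Rightarrow> ('n::finite, 'm::finite) jcoord \<Rightarrow> ('n, 'm) jcoord \<Rightarrow> real" where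
  "contact \<sigma> p u =
     fst (snd u) $ \<sigma> - (\<Sum>j\<in>UNIV. snd (snd p) $ \<sigma> $ j * fst u $ j)"

definition Gamma_field ::
  "(('n, 'm) jcoord \<Rightarrow> real^'n^'n^'m) \<Rightarrow> 'n::finite \<Rightarrow> ('n, 'm::finite) jcoord \<Rightarrow>
   ('n, 'm) jcoord" where
  "Gamma_field F i p = (axis i 1, \<chi> \<sigma>. snd (snd p) $ \<sigma> $ i, \<chi> \<sigma> j. F p $ \<sigma> $ i $ j)"

definition D_Gamma ::
  "(('n, 'm) jcoord \<Rightarrow> real^'n^'n^'m) \<Rightarrow> ('n::finite, 'm::finite) jcoord \<Rightarrow>
   ('n, 'm) jcoord set" where
  "D_Gamma F p = span (range (\<lambda>i. Gamma_field F i p))"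

definition G_proj ::
  "(('n, 'm) jcoord \<Rightarrow> real^'n^'n^'m) \<Rightarrow> ('n::finite, 'm::finite) jcoord vform" where
  "G_proj F p w = (\<Sum>i\<in>UNIV. fst (w 0) $ i *\<^sub>R Gamma_field F i p)"

definition S_form :: "(real^'n \<Rightarrow> real^'n) \<Rightarrow> ('n::finite, 'm::finite) jcoord vform" where
  "S_form \<phi> p w = (0, 0, \<chi> \<sigma> i. \<phi> (fst p) $ i * contact \<sigma> p (w 0))"

definition Gamma_v ::
  "(('n, 'm) jcoord \<Rightarrow> real^'n^'n^'m) \<Rightarrow> (real^'n \<Rightarrow> real^'n) \<Rightarrow>
   ('n::finite, 'm::finite) jcoord \<Rightarrow> ('n, 'm) jcoord" where
  "Gamma_v F v p = (\<Sum>i\<in>UNIV. v (fst p) $ i *\<^sub>R Gamma_field F i p)"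

definition lie_S ::
  "(('n, 'm) jcoord \<Rightarrow> real^'n^'n^'m) \<Rightarrow> (real^'n \<Rightarrow> real^'n) \<Rightarrow> (real^'n \<Rightarrow> real^'n) \<Rightarrow>
   ('n::finite, 'm::finite) jcoord vform" where
  "lie_S F \<phi> v = lie_vform 1 (Gamma_v F v) (S_form \<phi>)"

definition H_dist ::
  "(('n, 'm) jcoord \<Rightarrow> real^'n^'n^'m) \<Rightarrow> (real^'n \<Rightarrow> real^'n) \<Rightarrow> (real^'n \<Rightarrow> real^'n) \<Rightarrow>
   ('n::finite, 'm::finite) jcoord \<Rightarrow> ('n, 'm) jcoord set" where
  "H_dist F \<phi> v p = eigenspace (lie_S F \<phi> v) (-1) p"

definition D_plus ::
  "(('n, 'm) jcoord \<Rightarrow> real^'n^'n^'m) \<Rightarrow> (real^'n \<Rightarrow> real^'n) \<Rightarrow> (real^'n \<Rightarrow> real^'n) \<Rightarrow>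
   ('n::finite, 'm::finite) jcoord \<Rightarrow> ('n, 'm) jcoord set" where
  "D_plus F \<phi> v p = eigenspace (lie_S F \<phi> v) 1 p"

definition vertical10 :: "('n::finite, 'm::finite) jcoord set" where
  "vertical10 = {u. fst u = 0 \<and> fst (snd u) = 0}"

definition D_zero_vert ::
  "(('n, 'm) jcoord \<Rightarrow> real^'n^'n^'m) \<Rightarrow> (real^'n \<Rightarrow> real^'n) \<Rightarrow> (real^'n \<Rightarrow> real^'n) \<Rightarrow>
   ('n::finite, 'm::finite) jcoord \<Rightarrow> ('n, 'm) jcoord set" where
  "D_zero_vert F \<phi> v p = eigenspace (lie_S F \<phi> v) 0 p \<inter> vertical10"

definition P_proj ::
  "(('n, 'm) jcoord \<Rightarrow> real^'n^'n^'m) \<Rightarrow> (real^'n \<Rightarrow> real^'n) \<Rightarrow> (real^'n \<Rightarrow> real^'n) \<Rightarrow>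
   ('n::finite, 'm::finite) jcoord vform" where
  "P_proj F \<phi> v p w =
     projector (H_dist F \<phi> v p)
       (span (D_Gamma F p \<union> D_zero_vert F \<phi> v p \<union> D_plus F \<phi> v p)) (w 0)"

definition Q_tilde ::
  "(('n, 'm) jcoord \<Rightarrow> real^'n^'n^'m) \<Rightarrow> (real^'n \<Rightarrow> real^'n) \<Rightarrow> (real^'n \<Rightarrow> real^'n) \<Rightarrow>
   ('n::finite, 'm::finite) jcoord vform" where
  "Q_tilde F \<phi> v p w =
     projector (D_zero_vert F \<phi> v p)
       (span (D_Gamma F p \<union> H_dist F \<phi> v p \<union> D_plus F \<phi> v p)) (w 0)"

definition Q_plus ::
  "(('n, 'm) jcoord \<Rightarrow> real^'n^'n^'m) \<Rightarrow> (real^'n \<Rightarrow> real^'n) \<Rightarrow> (real^'n \<Rightarrow> real^'n) \<Rightarrow>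
   ('n::finite, 'm::finite) jcoord vform" where
  "Q_plus F \<phi> v p w =
     projector (D_plus F \<phi> v p)
       (span (D_Gamma F p \<union> H_dist F \<phi> v p \<union> D_zero_vert F \<phi> v p)) (w 0)"

definition Phi_plus ::
  "(('n, 'm) jcoord \<Rightarrow> real^'n^'n^'m) \<Rightarrow> (real^'n \<Rightarrow> real^'n) \<Rightarrow> (real^'n \<Rightarrow> real^'n) \<Rightarrow>
   ('n::finite, 'm::finite) jcoord vform" where
  "Phi_plus F \<phi> v = comp_vform (Q_plus F \<phi> v) (fn_bracket 1 1 (G_proj F) (P_proj F \<phi> v))"

definition r_plus ::
  "(('n, 'm) jcoord \<Rightarrow> real^'n^'n^'m) \<Rightarrow> (real^'n \<Rightarrow> real^'n) \<Rightarrow> (real^'n \<Rightarrow> real^'n) \<Rightarrow>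
   ('n::finite, 'm::finite) jcoord vform" where
  "r_plus F \<phi> v = comp_vform (Q_plus F \<phi> v) (fn_bracket 1 1 (G_proj F) (Q_tilde F \<phi> v))"

text \<open>The isomorphism of \<open>D_plus\<close> with the vertical bundle of the total space.\<close>

definition s_map ::
  "(real^'n \<Rightarrow> real^'n) \<Rightarrow> ('n::finite, 'm::finite) jcoord \<Rightarrow> ('n, 'm) jcoord \<Rightarrow>
   ('n, 'm) ycoord" where
  "s_map \<phi> p u = (0, THE t. u = (0, 0, \<chi> \<sigma> i. \<phi> (fst p) $ i * t $ \<sigma>))"

text \<open>In the following, \<open>Z\<close> is the coordinate representation of a local connection.\<close>

definition Z_field ::
  "(('n, 'm) ycoord \<Rightarrow> ('n, 'm) jcoord) \<Rightarrow> 'n::finite \<Rightarrow> ('n, 'm::finite) ycoord \<Rightarrow>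
   ('n, 'm) ycoord" where
  "Z_field Z i \<eta> = (axis i 1, \<chi> \<sigma>. snd (snd (Z \<eta>)) $ \<sigma> $ i)"

definition D_Z ::
  "(('n, 'm) ycoord \<Rightarrow> ('n, 'm) jcoord) \<Rightarrow> ('n::finite, 'm::finite) ycoord \<Rightarrow>
   ('n, 'm) ycoord set" where
  "D_Z Z \<eta> = span (range (\<lambda>i. Z_field Z i \<eta>))"

definition Z_v ::
  "(('n, 'm) ycoord \<Rightarrow> ('n, 'm) jcoord) \<Rightarrow> (real^'n \<Rightarrow> real^'n) \<Rightarrow>
   ('n::finite, 'm::finite) ycoord \<Rightarrow> ('n, 'm) ycoord" where
  "Z_v Z v \<eta> = (\<Sum>i\<in>UNIV. v (fst \<eta>) $ i *\<^sub>R Z_field Z i \<eta>)"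

definition Z_phi ::
  "(('n, 'm) ycoord \<Rightarrow> ('n, 'm) jcoord) \<Rightarrow> (real^'n \<Rightarrow> real^'n) \<Rightarrow> ('n, 'm) jcoord vform \<Rightarrow>
   ('n::finite, 'm::finite) ycoord vform" where
  "Z_phi Z \<phi> K \<eta> w = s_map \<phi> (Z \<eta>) (K (Z \<eta>) (\<lambda>k. frechet_derivative Z (at \<eta>) (w k)))"


section \<open>Embedded connections and the shape operator\<close>

definition embedded_connection ::
  "('x, 'n::finite) base \<Rightarrow> ('y, 'n, 'm::finite) total \<Rightarrow> ('y \<Rightarrow> 'x) \<Rightarrow>
   (('x, 'y) jet \<Rightarrow> ('x, 'y) jet) \<Rightarrow> 'y set \<Rightarrow> ('y \<Rightarrow> ('x, 'y) jet) \<Rightarrow> bool" where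
  "embedded_connection X Y \<pi> \<Gamma> V Z \<longleftrightarrow>
     (\<forall>C\<in>fibred_charts X Y \<pi>. \<forall>y\<in>fst (snd C) \<inter> V.
        let \<eta> = snd (snd C) y; Z' = connection_rep C Z in
        frechet_derivative Z' (at \<eta>) ` D_Z Z' \<eta> \<subseteq> D_Gamma (soc_components X Y \<pi> \<Gamma> C) (Z' \<eta>))"

text \<open>
  Components, in the fibred chart \<open>C\<close>, of the lift of \<open>v\<close>, of the shape operator and of the
  vector-valued \<open>2\<close>-forms on \<open>V\<close> obtained from the curvatures.
\<close>

definition horizontal_lift ::
  "('y \<Rightarrow> ('x, 'y) jet) \<Rightarrow> (('x, real^'n) chart \<Rightarrow> real^'n \<Rightarrow> real^'n) \<Rightarrow>
   ('x, 'y, 'n::finite, 'm::finite) fchart \<Rightarrow> ('n, 'm) ycoord \<Rightarrow> ('n, 'm) ycoord" where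
  "horizontal_lift Z v C = Z_v (connection_rep C Z) (v (fst C))"

definition shape_operator ::
  "('x, 'n::finite) base \<Rightarrow> ('y, 'n, 'm::finite) total \<Rightarrow> ('y \<Rightarrow> 'x) \<Rightarrow>
   (('x, 'y) jet \<Rightarrow> ('x, 'y) jet) \<Rightarrow> (('x, real^'n) chart \<Rightarrow> real^'n \<Rightarrow> real^'n) \<Rightarrow>
   (('x, real^'n) chart \<Rightarrow> real^'n \<Rightarrow> real^'n) \<Rightarrow> ('y \<Rightarrow> ('x, 'y) jet) \<Rightarrow>
   ('x, 'y, 'n, 'm) fchart \<Rightarrow> ('n, 'm) ycoord vform" where
  "shape_operator X Y \<pi> \<Gamma> \<phi> v Z C =
     Z_phi (connection_rep C Z) (\<phi> (fst C))
       (Q_plus (soc_components X Y \<pi> \<Gamma> C) (\<phi> (fst C)) (v (fst C)))"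

definition Z_phi_Phi_plus ::
  "('x, 'n::finite) base \<Rightarrow> ('y, 'n, 'm::finite) total \<Rightarrow> ('y \<Rightarrow> 'x) \<Rightarrow>
   (('x, 'y) jet \<Rightarrow> ('x, 'y) jet) \<Rightarrow> (('x, real^'n) chart \<Rightarrow> real^'n \<Rightarrow> real^'n) \<Rightarrow>
   (('x, real^'n) chart \<Rightarrow> real^'n \<Rightarrow> real^'n) \<Rightarrow> ('y \<Rightarrow> ('x, 'y) jet) \<Rightarrow>
   ('x, 'y, 'n, 'm) fchart \<Rightarrow> ('n, 'm) ycoord vform" where
  "Z_phi_Phi_plus X Y \<pi> \<Gamma> \<phi> v Z C =
     Z_phi (connection_rep C Z) (\<phi> (fst C))
       (Phi_plus (soc_components X Y \<pi> \<Gamma> C) (\<phi> (fst C)) (v (fst C)))"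

definition Z_phi_r_plus ::
  "('x, 'n::finite) base \<Rightarrow> ('y, 'n, 'm::finite) total \<Rightarrow> ('y \<Rightarrow> 'x) \<Rightarrow>
   (('x, 'y) jet \<Rightarrow> ('x, 'y) jet) \<Rightarrow> (('x, real^'n) chart \<Rightarrow> real^'n \<Rightarrow> real^'n) \<Rightarrow>
   (('x, real^'n) chart \<Rightarrow> real^'n \<Rightarrow> real^'n) \<Rightarrow> ('y \<Rightarrow> ('x, 'y) jet) \<Rightarrow>
   ('x, 'y, 'n, 'm) fchart \<Rightarrow> ('n, 'm) ycoord vform" where
  "Z_phi_r_plus X Y \<pi> \<Gamma> \<phi> v Z C =
     Z_phi (connection_rep C Z) (\<phi> (fst C))
       (r_plus (soc_components X Y \<pi> \<Gamma> C) (\<phi> (fst C)) (v (fst C)))"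

text \<open>Two tensor fields of the same type on \<open>V\<close> agree iff their components do in all fibred charts.\<close>

definition vforms_equal ::
  "('x, 'n::finite) base \<Rightarrow> ('y, 'n, 'm::finite) total \<Rightarrow> ('y \<Rightarrow> 'x) \<Rightarrow> 'y set \<Rightarrow>
   (('x, 'y, 'n, 'm) fchart \<Rightarrow> ('n, 'm) ycoord vform) \<Rightarrow>
   (('x, 'y, 'n, 'm) fchart \<Rightarrow> ('n, 'm) ycoord vform) \<Rightarrow> bool" where
  "vforms_equal X Y \<pi> V K L \<longleftrightarrow>
     (\<forall>C\<in>fibred_charts X Y \<pi>. \<forall>y\<in>fst (snd C) \<inter> V. \<forall>w.
        K C (snd (snd C) y) w = L C (snd (snd C) y) w)"

end

(*
  In a fibred chart let G and Q be the projectors onto D_Gamma and D_+. The four projectors add up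
  to the identity, which has vanishing bracket with G, so Phi_+ + r_+ = - Q o ([[G, G]] + [[G, Q]]).
  Embeddedness, differentiated once more, expresses the second derivative of Z along D_Z through
  the first derivative of Gamma_i and makes the curvature [[G, G]] vanish along the image of Z.
  Hence both sides of the claim reduce to first derivatives of Q and G at points of that image.
  What remains is an identity for v^k H_k, which is the eigenvalue equation defining H contracted
  with v. All of this works in charts that are not adapted to phi.

  The only global input is that the chart domain of the first jet bundle is open, so that the
  components of Gamma can be differentiated there: every point of it is the jet of a local section
  that is affine in the chart.
*)

theory Submission
  imports Defs
begin

section \<open>Calculus\<close>

text \<open>Everything is measured by one fibre-valued form \<open>q\<close>, with \<open>Q\<close>
  equal to \<open>\<phi>_up\<close> after \<open>q\<close>. It kills the other three summands, so
  that the fibre part of A_Z is simply \<open>q\<close> after TZ. Since \<open>q\<close> contains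
  DF, its derivative involves second derivatives of F, but it is never expanded: along \<Gamma>_v it
  enters both sides of the claim in the same way. The projectors are given through eigenspaces and
  unique existence. They need closed forms on a whole open set before the bracket can differentiate
  them. Two cancellations remain. The term v^k H_k arises from A_Z^2, because TZ maps a vertical
  vector (0, t) to one with contact part t, and also from the derivative of G along D_+. The
  derivative of \<phi> along v, which is zero when \<phi> = dx^1, arises from differentiating the
  factor \<phi> in Q and from the eigenvalue equation of H. In both cases the two contributions have
  opposite signs.\<close>

lemma Ck_on_subset: "Ck_on k S f \<Longrightarrow> T \<subseteq> S \<Longrightarrow> Ck_on k T f"
  by (induction k arbitrary: f) (auto intro: continuous_on_subset)

text \<open>Openness of \<open>S\<close> matters: the Frechet derivative at a point of
  \<open>S\<close> sees a whole neighbourhood, and there \<open>f\<close> and \<open>g\<close> have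
  to agree.\<close>

lemma Ck_on_cong:
  assumes "open S" "\<And>x. x \<in> S \<Longrightarrow> f x = g x" "Ck_on k S f"
  shows "Ck_on k S g"
  using assms(2,3)
proof (induction k arbitrary: f g)
  case 0
  then show ?case using continuous_on_cong by (metis Ck_on.simps(1))
next
  case (Suc k)
  have d: "(g has_derivative frechet_derivative f (at x)) (at x)" if "x \<in> S" for x
    using has_derivative_transform_within_open[OF _ assms(1) that, of f _ UNIV g] Suc.prems that
    by (auto simp: frechet_derivative_works)
  then have e: "frechet_derivative g (at x) = frechet_derivative f (at x)" if "x \<in> S" for x
    using frechet_derivative_at that by metis
  have "Ck_on k S (\<lambda>x. frechet_derivative g (at x) u)" for u
    by (rule Suc.IH[of "\<lambda>x. frechet_derivative f (at x) u"]) (use Suc.prems e in auto)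
  with d show ?case by (auto simp: differentiable_def)
qed

lemma Ck_on_Suc_imp: "Ck_on (Suc k) S f \<Longrightarrow> Ck_on k S f"
proof (induction k arbitrary: f)
  case 0
  then show ?case
    by (auto intro!: continuous_at_imp_continuous_on differentiable_imp_continuous_within)
next
  case (Suc k)
  then show ?case using Ck_on.simps(2) by blast
qed

lemma Ck_on_const: "Ck_on k S (\<lambda>x. c)"
  by (induction k arbitrary: c) auto

lemma Ck_on_Suc_I:
  assumes "open S" "\<And>x. x \<in> S \<Longrightarrow> (f has_derivative f' x) (at x)"
    "\<And>u. Ck_on k S (\<lambda>x. f' x u)"
  shows "Ck_on (Suc k) S f"
proof -
  have "frechet_derivative f (at x) = f' x" if "x \<in> S" for x
    using frechet_derivative_at assms(2) that by metis
  then have "Ck_on k S (\<lambda>x. frechet_derivative f (at x) u)" for u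
    by (intro Ck_on_cong[OF assms(1) _ assms(3)[of u]]) auto
  with assms(2) show ?thesis by (auto simp: differentiable_def)
qed

lemma Ck_on_SucD:
  assumes "Ck_on (Suc k) S f"
  shows "x \<in> S \<Longrightarrow> (f has_derivative frechet_derivative f (at x)) (at x)"
    "Ck_on k S (\<lambda>x. frechet_derivative f (at x) u)"
  using assms by (auto simp: frechet_derivative_works)

lemma Ck_on_bounded_linear:
  assumes "bounded_linear L" "open S" "Ck_on k S f"
  shows "Ck_on k S (\<lambda>x. L (f x))"
  using assms(3)
proof (induction k arbitrary: f)
  case 0
  then show ?case using assms(1) by (auto intro: bounded_linear.continuous_on)
next
  case (Suc k)
  show ?case
    by (rule Ck_on_Suc_I[OF assms(2)])
      (use bounded_linear.has_derivative[OF assms(1) Ck_on_SucD(1)[OF Suc.prems]]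
        Suc.IH[OF Ck_on_SucD(2)[OF Suc.prems]] in auto)
qed

lemma Ck_on_ident: "open S \<Longrightarrow> Ck_on k S (\<lambda>x. x)"
  by (cases k) (auto intro!: continuous_intros Ck_on_Suc_I[where f'="\<lambda>_ h. h"] Ck_on_const)

lemma Ck_on_add:
  assumes "open S" "Ck_on k S f" "Ck_on k S g"
  shows "Ck_on k S (\<lambda>x. f x + g x)"
  using assms(2,3)
proof (induction k arbitrary: f g)
  case 0
  then show ?case by (auto intro: continuous_intros)
next
  case (Suc k)
  show ?case
    by (rule Ck_on_Suc_I[OF assms(1)])
      (use has_derivative_add[OF Suc.prems[THEN Ck_on_SucD(1)]]
        Suc.IH[OF Suc.prems[THEN Ck_on_SucD(2)]] in auto)
qed

lemma Ck_on_sum: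
  assumes "open S" "finite A" "\<And>a. a \<in> A \<Longrightarrow> Ck_on k S (f a)"
  shows "Ck_on k S (\<lambda>x. \<Sum>a\<in>A. f a x)"
  using assms(2,3) by (induction A) (auto intro: Ck_on_add[OF assms(1)] Ck_on_const)

lemma Ck_on_bilinear:
  assumes "bounded_bilinear B" "open S" "Ck_on k S f" "Ck_on k S g"
  shows "Ck_on k S (\<lambda>x. B (f x) (g x))"
  using assms(3,4)
proof (induction k arbitrary: f g)
  case 0
  then show ?case using assms(1) by (auto intro: bounded_bilinear.continuous_on)
next
  case (Suc k)
  have "Ck_on k S (\<lambda>x. B (f x) (frechet_derivative g (at x) u) + B (frechet_derivative f (at x) u) (g x))" for u
    by (intro Ck_on_add assms(2) Suc.IH Ck_on_Suc_imp[OF Suc.prems(1)]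
        Ck_on_Suc_imp[OF Suc.prems(2)] Suc.prems[THEN Ck_on_SucD(2)])
  then show ?case
    by (intro Ck_on_Suc_I[OF assms(2)
          bounded_bilinear.FDERIV[OF assms(1) Suc.prems[THEN Ck_on_SucD(1)]]]) auto
qed

lemma linear_expand:
  fixes L :: "'a::euclidean_space \<Rightarrow> 'b::real_vector"
  assumes "linear L"
  shows "L u = (\<Sum>b\<in>Basis. (u \<bullet> b) *\<^sub>R L b)"
proof -
  have "L u = L (\<Sum>b\<in>Basis. (u \<bullet> b) *\<^sub>R b)" by (simp add: euclidean_representation)
  also have "\<dots> = (\<Sum>b\<in>Basis. (u \<bullet> b) *\<^sub>R L b)"
    using assms by (simp add: linear_sum linear_cmul)
  finally show ?thesis .
qed

text \<open>The chain rule differentiates \<open>g\<close> in a direction that moves with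
  \<open>x\<close>, whereas \<open>Ck_on\<close> speaks of fixed directions. Expanding the moving
  direction in the basis leaves scalar multiples of derivatives in fixed directions, to which the
  induction hypothesis applies.\<close>

lemma Ck_on_compose:
  fixes f :: "'a::euclidean_space \<Rightarrow> 'b::euclidean_space" and g :: "'b \<Rightarrow> 'c::real_normed_vector"
  assumes "open S" "f ` S \<subseteq> T" "Ck_on k S f" "Ck_on k T g"
  shows "Ck_on k S (\<lambda>x. g (f x))"
  using assms(3,4)
proof (induction k arbitrary: g)
  case 0
  then show ?case using assms(2) by (auto intro: continuous_on_compose2)
next
  case (Suc k)
  have f: "f x \<in> T" if "x \<in> S" for x using assms(2) that by auto
  have *: "((\<lambda>x. g (f x)) has_derivative
      (\<lambda>u. frechet_derivative g (at (f x)) (frechet_derivative f (at x) u))) (at x)" if "x \<in> S" for x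
    using diff_chain_at[OF Ck_on_SucD(1)[OF Suc.prems(1) that] Ck_on_SucD(1)[OF Suc.prems(2) f[OF that]]]
    by (simp add: o_def)
  have "Ck_on k S (\<lambda>x. \<Sum>b\<in>Basis. (frechet_derivative f (at x) u \<bullet> b) *\<^sub>R frechet_derivative g (at (f x)) b)" for u
    by (intro Ck_on_sum assms(1) finite_Basis Ck_on_bilinear[OF bounded_bilinear_scaleR assms(1)]
        Ck_on_bounded_linear[OF bounded_linear_inner_left assms(1)] Ck_on_SucD(2)[OF Suc.prems(1)]
        Suc.IH[OF Ck_on_Suc_imp[OF Suc.prems(1)] Ck_on_SucD(2)[OF Suc.prems(2)]])
  then have "Ck_on k S (\<lambda>x. frechet_derivative g (at (f x)) (frechet_derivative f (at x) u))" for u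
    by (rule Ck_on_cong[OF assms(1), rotated])
      (rule linear_expand[symmetric, OF linear_frechet_derivative], use Suc.prems(2) f in auto)
  then show ?case by (intro Ck_on_Suc_I[OF assms(1) *])
qed

lemma Ck_on_Pair:
  assumes "open S" "Ck_on k S f" "Ck_on k S g"
  shows "Ck_on k S (\<lambda>x. (f x, g x))"
  using assms(2,3)
proof (induction k arbitrary: f g)
  case 0
  then show ?case by (auto intro: continuous_intros)
next
  case (Suc k)
  show ?case
    by (rule Ck_on_Suc_I[OF assms(1)])
      (use has_derivative_Pair[OF Suc.prems[THEN Ck_on_SucD(1)]]
        Suc.IH[OF Suc.prems[THEN Ck_on_SucD(2)]] in auto)
qed

text \<open>Both iterated derivatives are limits of the second difference quotient of \<open>f\<close>.\<close>

lemma symmetric_second_derivative_real: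
  fixes f :: "'a::euclidean_space \<Rightarrow> real"
  assumes S: "open S" "x \<in> S" and f: "Ck_on 2 S f"
  shows "frechet_derivative (\<lambda>x. frechet_derivative f (at x) u) (at x) v =
    frechet_derivative (\<lambda>x. frechet_derivative f (at x) v) (at x) u"
proof -
  define D where "D u x = frechet_derivative f (at x) u" for u x
  define D2 where "D2 u v x = frechet_derivative (D u) (at x) v" for u v x
  have f': "Ck_on (Suc (Suc 0)) S f" using f by (simp add: numeral_2_eq_2)
  have 1: "(f has_derivative (\<lambda>h. D h y)) (at y)" if "y \<in> S" for y
    using Ck_on_SucD(1)[OF f' that] by (simp add: D_def)
  have 2: "(D u has_derivative (\<lambda>h. D2 u h y)) (at y)" if "y \<in> S" for y u
    using Ck_on_SucD(1)[OF Ck_on_SucD(2)[OF f'] that] by (simp add: D_def[abs_def] D2_def)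
  have 3: "continuous_on S (D2 u v)" for u v
    using Ck_on_SucD(2)[OF Ck_on_SucD(2)[OF f'], of u v] by (simp add: D_def[abs_def] D2_def[abs_def])
  have lin: "D (c *\<^sub>R h) y = c * D h y" "D2 u (c *\<^sub>R h) y = c * D2 u h y" if "y \<in> S" for c h y u
    using linear_cmul[OF has_derivative_linear[OF 1[OF that]]]
      linear_cmul[OF has_derivative_linear[OF 2[OF that]]] by auto
  obtain e where e: "e > 0" "ball x e \<subseteq> S" using S open_contains_ball by metis
  \<comment> \<open>For coefficients below \<open>r\<close> the whole parallelogram stays in the
    ball of radius \<open>e\<close>. The summand 1 keeps the denominator positive when
    \<open>u\<close> and \<open>v\<close> are zero.\<close>
  define r where "r = e / (norm u + norm v + 1)"
  have r: "r > 0" using e by (simp add: r_def add_nonneg_pos)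
  have inS: "x + a *\<^sub>R u + b *\<^sub>R v \<in> S" if "0 \<le> a" "a < r" "0 \<le> b" "b < r" for a b
  proof -
    have "norm (a *\<^sub>R u + b *\<^sub>R v) \<le> a * norm u + b * norm v"
      using that norm_triangle_ineq[of "a *\<^sub>R u" "b *\<^sub>R v"] by simp
    also have "\<dots> \<le> r * norm u + r * norm v" using that by (intro add_mono mult_right_mono) auto
    also have "\<dots> < r * (norm u + norm v + 1)" using r by (simp add: algebra_simps)
    also have "\<dots> = e" unfolding r_def using add_nonneg_pos[of "norm u + norm v" 1] by simp
    finally show ?thesis using e by (intro subsetD[OF e(2)]) (simp add: dist_norm algebra_simps norm_minus_commute)
  qed
  \<comment> \<open>The mean value theorem is applied twice: in direction \<open>u\<close> to a
    difference along \<open>v\<close>, then in direction \<open>v\<close> to \<open>D u\<close>. The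
    vectors and the inclusion \<open>inS\<close> are generalized so that the same fact serves the
    swapped order.\<close>
  have key: "\<exists>a b. 0 \<le> a \<and> a < s \<and> 0 \<le> b \<and> b < s \<and>
      f (x + s *\<^sub>R u + s *\<^sub>R v) - f (x + s *\<^sub>R u) - f (x + s *\<^sub>R v) + f x =
      s * s * D2 u v (x + a *\<^sub>R u + b *\<^sub>R v)"
    if s: "0 < s" "s < r" and inS: "\<And>a b. 0 \<le> a \<Longrightarrow> a < r \<Longrightarrow> 0 \<le> b \<Longrightarrow> b < r \<Longrightarrow> x + a *\<^sub>R u + b *\<^sub>R v \<in> S"
    for s u v
  proof -
    let ?g = "\<lambda>a. f (x + a *\<^sub>R u + s *\<^sub>R v) - f (x + a *\<^sub>R u)"
    have "DERIV ?g a :> D u (x + a *\<^sub>R u + s *\<^sub>R v) - D u (x + a *\<^sub>R u)" if "0 \<le> a" "a \<le> s" for a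
    proof -
      have m: "x + a *\<^sub>R u + s *\<^sub>R v \<in> S" "x + a *\<^sub>R u \<in> S"
        using inS[of a s] inS[of a 0] that s by auto
      have "(?g has_derivative (\<lambda>h. D (h *\<^sub>R u) (x + a *\<^sub>R u + s *\<^sub>R v) - D (h *\<^sub>R u) (x + a *\<^sub>R u))) (at a)"
      proof (intro has_derivative_diff)
        have "((\<lambda>a. x + a *\<^sub>R u + s *\<^sub>R v) has_derivative (\<lambda>h. h *\<^sub>R u)) (at a)"
          by (auto intro!: derivative_eq_intros)
        from diff_chain_at[OF this 1[OF m(1)], unfolded o_def]
        show "((\<lambda>a. f (x + a *\<^sub>R u + s *\<^sub>R v)) has_derivative (\<lambda>h. D (h *\<^sub>R u) (x + a *\<^sub>R u + s *\<^sub>R v))) (at a)" .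
        have "((\<lambda>a. x + a *\<^sub>R u) has_derivative (\<lambda>h. h *\<^sub>R u)) (at a)"
          by (auto intro!: derivative_eq_intros)
        from diff_chain_at[OF this 1[OF m(2)], unfolded o_def]
        show "((\<lambda>a. f (x + a *\<^sub>R u)) has_derivative (\<lambda>h. D (h *\<^sub>R u) (x + a *\<^sub>R u))) (at a)" .
      qed
      then show ?thesis
        unfolding has_field_derivative_def
        by (rule has_derivative_eq_rhs) (use lin m in \<open>auto simp: fun_eq_iff algebra_simps\<close>)
    qed
    from MVT2[OF s(1), of ?g, OF this] obtain a where a: "0 < a" "a < s"
      "?g s - ?g 0 = s * (D u (x + a *\<^sub>R u + s *\<^sub>R v) - D u (x + a *\<^sub>R u))" by auto
    have "DERIV (\<lambda>b. D u (x + a *\<^sub>R u + b *\<^sub>R v)) b :> D2 u v (x + a *\<^sub>R u + b *\<^sub>R v)" if "0 \<le> b" "b \<le> s" for b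
    proof -
      have m: "x + a *\<^sub>R u + b *\<^sub>R v \<in> S" using inS[of a b] that s a by auto
      have "((\<lambda>b. x + a *\<^sub>R u + b *\<^sub>R v) has_derivative (\<lambda>h. h *\<^sub>R v)) (at b)"
        by (auto intro!: derivative_eq_intros)
      from diff_chain_at[OF this 2[OF m], unfolded o_def]
      have "((\<lambda>b. D u (x + a *\<^sub>R u + b *\<^sub>R v)) has_derivative (\<lambda>h. D2 u (h *\<^sub>R v) (x + a *\<^sub>R u + b *\<^sub>R v))) (at b)" .
      then show ?thesis
        unfolding has_field_derivative_def
        by (rule has_derivative_eq_rhs) (use lin m in \<open>auto simp: fun_eq_iff algebra_simps\<close>)
    qed
    from MVT2[OF s(1) this] obtain b where b: "0 < b" "b < s"
      "D u (x + a *\<^sub>R u + s *\<^sub>R v) - D u (x + a *\<^sub>R u + 0 *\<^sub>R v) = s * D2 u v (x + a *\<^sub>R u + b *\<^sub>R v)"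
      by auto
    show ?thesis
      using a b by (intro exI[of _ a] exI[of _ b]) (simp add: algebra_simps)
  qed
  have "\<bar>D2 u v x - D2 v u x\<bar> \<le> \<epsilon>" if eps: "\<epsilon> > 0" for \<epsilon>
  proof -
    have c: "continuous (at x) (D2 u v)" "continuous (at x) (D2 v u)"
      using 3 S by (auto simp: continuous_on_eq_continuous_at)
    obtain d1 where d1: "d1 > 0" "\<And>y. dist y x < d1 \<Longrightarrow> \<bar>D2 u v y - D2 u v x\<bar> < \<epsilon>/2"
      using c(1)[unfolded continuous_at_eps_delta, rule_format, of "\<epsilon>/2"] eps
      by (auto simp: dist_real_def)
    obtain d2 where d2: "d2 > 0" "\<And>y. dist y x < d2 \<Longrightarrow> \<bar>D2 v u y - D2 v u x\<bar> < \<epsilon>/2"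
      using c(2)[unfolded continuous_at_eps_delta, rule_format, of "\<epsilon>/2"] eps
      by (auto simp: dist_real_def)
    define d where "d = min d1 d2"
    \<comment> \<open>The side \<open>s\<close> is so small that the parallelogram lies in
      \<open>S\<close> and all intermediate points lie within the distance \<open>d\<close> given by
      continuity of both second derivatives.\<close>
    define s where "s = min (r/2) (d / (norm u + norm v + 1))"
    have d: "d > 0" using d1 d2 by (simp add: d_def)
    have s: "0 < s" "s < r" using r d by (auto simp: s_def add_nonneg_pos)
    have near: "dist (x + a *\<^sub>R u + b *\<^sub>R v) x < d" if "0 \<le> a" "a < s" "0 \<le> b" "b < s" for a b
    proof -
      have "norm (a *\<^sub>R u + b *\<^sub>R v) \<le> a * norm u + b * norm v"
        using that norm_triangle_ineq[of "a *\<^sub>R u" "b *\<^sub>R v"] by simp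
      also have "\<dots> \<le> s * norm u + s * norm v" using that by (intro add_mono mult_right_mono) auto
      also have "\<dots> < s * (norm u + norm v + 1)" using s by (simp add: algebra_simps)
      also have "\<dots> \<le> d / (norm u + norm v + 1) * (norm u + norm v + 1)"
        by (intro mult_right_mono) (auto simp: s_def)
      also have "\<dots> = d" using add_nonneg_pos[of "norm u + norm v" 1] by simp
      finally show ?thesis by (simp add: dist_norm add.assoc)
    qed
    obtain a b where ab: "0 \<le> a" "a < s" "0 \<le> b" "b < s"
      "f (x + s *\<^sub>R u + s *\<^sub>R v) - f (x + s *\<^sub>R u) - f (x + s *\<^sub>R v) + f x =
      s * s * D2 u v (x + a *\<^sub>R u + b *\<^sub>R v)"
      using key[OF s inS] by auto
    obtain a' b' where ab': "0 \<le> a'" "a' < s" "0 \<le> b'" "b' < s"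
      "f (x + s *\<^sub>R v + s *\<^sub>R u) - f (x + s *\<^sub>R v) - f (x + s *\<^sub>R u) + f x =
      s * s * D2 v u (x + a' *\<^sub>R v + b' *\<^sub>R u)"
    proof -
      have "x + a *\<^sub>R v + b *\<^sub>R u \<in> S" if "0 \<le> a" "a < r" "0 \<le> b" "b < r" for a b
        using inS[OF that(3,4,1,2)] by (simp add: algebra_simps)
      from key[OF s this] show ?thesis using that by auto
    qed
    have "s * s * D2 u v (x + a *\<^sub>R u + b *\<^sub>R v) = s * s * D2 v u (x + b' *\<^sub>R u + a' *\<^sub>R v)"
      using ab(5) ab'(5) by (simp add: algebra_simps)
    then have "D2 u v (x + a *\<^sub>R u + b *\<^sub>R v) = D2 v u (x + b' *\<^sub>R u + a' *\<^sub>R v)"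
      using s by simp
    moreover have "\<bar>a - e1\<bar> < \<epsilon>/2 \<Longrightarrow> \<bar>a - e2\<bar> < \<epsilon>/2 \<Longrightarrow> \<bar>e1 - e2\<bar> \<le> \<epsilon>" for a e1 e2 :: real
      by linarith
    ultimately show ?thesis
      using d1(2)[of "x + a *\<^sub>R u + b *\<^sub>R v"] d2(2)[of "x + b' *\<^sub>R u + a' *\<^sub>R v"]
        near[OF ab(1-4)] near[OF ab'(3,4,1,2)] unfolding d_def
      by (metis min_less_iff_conj)
  qed
  then have "\<bar>D2 u v x - D2 v u x\<bar> \<le> 0" by (rule field_le_epsilon) auto
  then show ?thesis by (simp add: D2_def D_def[abs_def])
qed

lemma symmetric_second_derivative:
  fixes f :: "'a::euclidean_space \<Rightarrow> 'b::euclidean_space"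
  assumes S: "open S" "x \<in> S" and f: "Ck_on 2 S f"
  shows "frechet_derivative (\<lambda>x. frechet_derivative f (at x) u) (at x) v =
    frechet_derivative (\<lambda>x. frechet_derivative f (at x) v) (at x) u"
proof (rule euclidean_eqI)
  fix b :: 'b
  have f': "Ck_on (Suc (Suc 0)) S f" using f by (simp add: numeral_2_eq_2)
  have fb: "Ck_on 2 S (\<lambda>x. f x \<bullet> b)"
    by (rule Ck_on_bounded_linear[OF bounded_linear_inner_left S(1) f])
  have 1: "frechet_derivative (\<lambda>x. f x \<bullet> b) (at y) h = frechet_derivative f (at y) h \<bullet> b" if "y \<in> S" for y h
    using frechet_derivative_at[OF bounded_linear.has_derivative[OF bounded_linear_inner_left Ck_on_SucD(1)[OF f' that]]]
    by metis
  have "frechet_derivative (\<lambda>x. frechet_derivative f (at x) u) (at x) v \<bullet> b =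
     frechet_derivative (\<lambda>x. frechet_derivative (\<lambda>x. f x \<bullet> b) (at x) u) (at x) v" for u v
  proof -
    have "((\<lambda>x. frechet_derivative f (at x) u \<bullet> b) has_derivative
        (\<lambda>h. frechet_derivative (\<lambda>x. frechet_derivative f (at x) u) (at x) h \<bullet> b)) (at x)"
      by (rule bounded_linear.has_derivative[OF bounded_linear_inner_left
            Ck_on_SucD(1)[OF Ck_on_SucD(2)[OF f'] S(2)]])
    then have "((\<lambda>x. frechet_derivative (\<lambda>x. f x \<bullet> b) (at x) u) has_derivative
        (\<lambda>h. frechet_derivative (\<lambda>x. frechet_derivative f (at x) u) (at x) h \<bullet> b)) (at x)"
      by (rule has_derivative_transform_within_open[OF _ S]) (simp add: 1)
    then show ?thesis using frechet_derivative_at by metis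
  qed
  then show "frechet_derivative (\<lambda>x. frechet_derivative f (at x) u) (at x) v \<bullet> b =
    frechet_derivative (\<lambda>x. frechet_derivative f (at x) v) (at x) u \<bullet> b"
    using symmetric_second_derivative_real[OF S fb] by metis
qed

text \<open>A product rule for a family of linear maps that is known only through its values on
  fixed vectors. Expanding \<open>f y\<close> in the basis turns \<open>k y (f y)\<close> into a
  finite sum of products; linearity of \<open>k' h\<close> follows from uniqueness of
  derivatives.\<close>

lemma has_derivative_family:
  fixes k :: "'a::euclidean_space \<Rightarrow> 'b::euclidean_space \<Rightarrow> 'c::real_normed_vector"
  assumes S: "open S" "x \<in> S" and lin: "\<And>y. y \<in> S \<Longrightarrow> linear (k y)"
    and k: "\<And>u. ((\<lambda>y. k y u) has_derivative (\<lambda>h. k' h u)) (at x)"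
    and f: "(f has_derivative f') (at x)"
  shows "((\<lambda>y. k y (f y)) has_derivative (\<lambda>h. k' h (f x) + k x (f' h))) (at x)"
    "linear (k' h)"
proof -
  show l: "linear (k' h)" for h
  proof
    fix a b :: 'b and c :: real
    have "((\<lambda>y. k y (a + b)) has_derivative (\<lambda>h. k' h a + k' h b)) (at x)"
      by (rule has_derivative_transform_within_open[OF has_derivative_add[OF k[of a] k[of b]] S])
        (simp add: linear_add lin)
    then show "k' h (a + b) = k' h a + k' h b" using has_derivative_unique[OF k] by metis
    have "((\<lambda>y. k y (c *\<^sub>R a)) has_derivative (\<lambda>h. c *\<^sub>R k' h a)) (at x)"
      by (rule has_derivative_transform_within_open[OF has_derivative_scaleR_right[OF k[of a]] S])
        (simp add: linear_cmul lin)
    then show "k' h (c *\<^sub>R a) = c *\<^sub>R k' h a" using has_derivative_unique[OF k] by metis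
  qed
  have "((\<lambda>y. \<Sum>b\<in>Basis. (f y \<bullet> b) *\<^sub>R k y b) has_derivative
      (\<lambda>h. \<Sum>b\<in>Basis. (f x \<bullet> b) *\<^sub>R k' h b + (f' h \<bullet> b) *\<^sub>R k x b)) (at x)"
    by (intro has_derivative_sum has_derivative_scaleR has_derivative_inner_left f k)
  moreover have "(\<lambda>h. \<Sum>b\<in>Basis. (f x \<bullet> b) *\<^sub>R k' h b + (f' h \<bullet> b) *\<^sub>R k x b) =
      (\<lambda>h. k' h (f x) + k x (f' h))"
    by (rule ext) (subst linear_expand[OF l], subst linear_expand[OF lin[OF S(2)]],
        simp add: sum.distrib)
  ultimately have "((\<lambda>y. \<Sum>b\<in>Basis. (f y \<bullet> b) *\<^sub>R k y b) has_derivative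
      (\<lambda>h. k' h (f x) + k x (f' h))) (at x)" by simp
  then show "((\<lambda>y. k y (f y)) has_derivative (\<lambda>h. k' h (f x) + k x (f' h))) (at x)"
    by (rule has_derivative_transform_within_open[OF _ S]) (rule linear_expand[symmetric, OF lin])
qed

section \<open>Low-degree Froelicher--Nijenhuis brackets\<close>

lemma permutes_lessThan_2: "{s. s permutes {..<2::nat}} = {id, Transposition.transpose 0 1}"
proof (rule card_subset_eq[symmetric])
  show "finite {s. s permutes {..<2::nat}}" by (rule finite_permutations) simp
  show "{id, Transposition.transpose 0 1} \<subseteq> {s. s permutes {..<2::nat}}"
    by (auto intro: permutes_id permutes_swap_id)
  have "card {s. s permutes {..<2::nat}} = fact 2" by (rule card_permutations) auto
  moreover have "id \<noteq> Transposition.transpose 0 (1::nat)" by (metis id_apply transpose_apply_first zero_neq_one)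
  ultimately show "card {id, Transposition.transpose 0 (1::nat)} = card {s. s permutes {..<2::nat}}" by simp
qed

lemma permutes_lessThan_1: "{s. s permutes {..<1::nat}} = {id}"
proof -
  have "{..<1::nat} = {0}" by auto
  then show ?thesis by simp
qed

lemma wedge_degree_2:
  assumes "p + q = 2"
  shows "wedge p q \<alpha> \<beta> x w =
    (\<alpha> x w * \<beta> x (\<lambda>k. w (p + k))
      - \<alpha> x (\<lambda>k. w (Transposition.transpose 0 1 k)) * \<beta> x (\<lambda>k. w (Transposition.transpose 0 1 (p + k)))) / (fact p * fact q)"
proof -
  have ne: "id \<noteq> Transposition.transpose 0 (1::nat)" by (metis id_apply transpose_apply_first zero_neq_one)
  show ?thesis
    unfolding wedge_def assms permutes_lessThan_2 using ne by (simp add: sign_swap_id)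
qed

lemma wedge_degree_1:
  assumes "p + q = 1"
  shows "wedge p q \<alpha> \<beta> x w = \<alpha> x w * \<beta> x (\<lambda>k. w (p + k))"
proof -
  have "fact p = (1::real)" "fact q = (1::real)" using assms by (cases p; auto)+
  then show ?thesis
    unfolding wedge_def assms permutes_lessThan_1 by simp
qed

text \<open>\<open>dk h u\<close> is the derivative along \<open>h\<close> of the value on the fixed
  vector \<open>u\<close>. The equation \<open>one\<close> is global because the form is handed to
  \<open>ext_d\<close> as a function; linearity and differentiability are local to
  \<open>x\<close>.\<close>

locale one_vform =
  fixes K :: "'e::euclidean_space vform" and k :: "'e \<Rightarrow> 'e \<Rightarrow> 'e" and x :: 'e
    and dk :: "'e \<Rightarrow> 'e \<Rightarrow> 'e"
  assumes one: "K = (\<lambda>x w. k x (w 0))"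
    and lin: "linear (k x)"
    and deriv: "((\<lambda>x. k x u) has_derivative (\<lambda>h. dk h u)) (at x)"
begin

lemma deriv_inner: "frechet_derivative (\<lambda>x. k x u \<bullet> b) (at x) h = dk h u \<bullet> b"
  using frechet_derivative_at[OF has_derivative_inner_left[OF deriv[of u], of b]] by metis

lemma ext_d_1: "ext_d 1 (\<lambda>x w. K x w \<bullet> b) x w = dk (w 0) (w 1) \<bullet> b - dk (w 1) (w 0) \<bullet> b"
  by (simp add: ext_d_def one deriv_inner)

text \<open>In the Cartan formula for a constant field the two derivatives along \<open>w 0\<close>
  cancel, which leaves the derivative of the coefficients along \<open>a\<close>.\<close>

lemma lie_form_1: "lie_form 1 (\<lambda>_. a) (\<lambda>x w. K x w \<bullet> b) x w = dk a (w 0) \<bullet> b"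
  using ext_d_1[of b "case_nat a w"]
  by (simp add: lie_form_def contract_def ext_d_def one deriv_inner)

end

lemma linear_expand_inner:
  assumes "linear (L :: 'a::euclidean_space \<Rightarrow> 'b::euclidean_space)"
  shows "(\<Sum>a\<in>Basis. (u \<bullet> a) * (L a \<bullet> b)) = L u \<bullet> b"
  using arg_cong[OF linear_expand[OF assms, of u], of "\<lambda>y. y \<bullet> b"] by (simp add: inner_sum_left)

text \<open>Constant basis fields have vanishing brackets, and the contraction of a form of degree 0
  is zero. Summed over the basis, the three surviving terms give the usual Lie derivative of a field
  of endomorphisms.\<close>

lemma lie_vform_1:
  assumes "one_vform K k x dk" and \<xi>: "(\<xi> has_derivative d\<xi>) (at x)"
  shows "lie_vform 1 \<xi> K x w = dk (\<xi> x) (w 0) + k x (d\<xi> (w 0)) - d\<xi> (k x (w 0))"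
proof -
  interpret one_vform K k x dk by fact
  have dk_lin: "linear (\<lambda>h. dk h u)" for u using deriv has_derivative_linear by blast
  have d\<xi>: "linear d\<xi>" using \<xi> has_derivative_linear by blast
  have fd: "frechet_derivative (\<lambda>x. \<xi> x \<bullet> a) (at x) h = d\<xi> h \<bullet> a" for a h
    using frechet_derivative_at[OF has_derivative_inner_left[OF \<xi>, of a]] by metis
  have term1: "fn_decomposable 0 1 (\<lambda>x w. \<xi> x \<bullet> a) (\<lambda>_. a) (\<lambda>x w. K x w \<bullet> b) (\<lambda>_. b) x w =
    ((\<xi> x \<bullet> a) * (dk a (w 0) \<bullet> b)) *\<^sub>R b - ((k x (w 0) \<bullet> b) * (d\<xi> b \<bullet> a)) *\<^sub>R a
      + ((d\<xi> (w 0) \<bullet> a) * (k x a \<bullet> b)) *\<^sub>R b" for a b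
  proof -
    have w1: "wedge 0 1 (\<lambda>x w. \<xi> x \<bullet> a) (lie_form 1 (\<lambda>_. a) (\<lambda>x w. K x w \<bullet> b)) x w =
        (\<xi> x \<bullet> a) * (dk a (w 0) \<bullet> b)"
      by (subst wedge_degree_1) (simp_all only: lie_form_1 add_0)
    have w2: "wedge 0 1 (lie_form 0 (\<lambda>_. b) (\<lambda>x w. \<xi> x \<bullet> a)) (\<lambda>x w. K x w \<bullet> b) x w =
        (k x (w 0) \<bullet> b) * (d\<xi> b \<bullet> a)"
      by (subst wedge_degree_1) (simp_all add: lie_form_def contract_def ext_d_def fd one)
    have w3: "wedge (0 + 1) (1 - 1) (ext_d 0 (\<lambda>x w. \<xi> x \<bullet> a)) (contract 1 (\<lambda>_. a) (\<lambda>x w. K x w \<bullet> b)) x w =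
        (d\<xi> (w 0) \<bullet> a) * (k x a \<bullet> b)"
      by (subst wedge_degree_1) (simp_all add: contract_def ext_d_def fd one)
    have w4: "wedge p q (contract 0 (\<lambda>_. b) (\<lambda>x w. \<xi> x \<bullet> a)) \<beta> x w = 0" for p q \<beta>
      by (simp add: wedge_def contract_def)
    show ?thesis
      unfolding fn_decomposable_def w1 w2 w3 w4 by (simp add: lie_bracket_def one)
  qed
  have "(\<Sum>a\<in>Basis. \<Sum>b\<in>Basis. ((\<xi> x \<bullet> a) * (dk a (w 0) \<bullet> b)) *\<^sub>R b) = dk (\<xi> x) (w 0)"
    by (subst sum.swap) (simp add: linear_expand_inner[OF dk_lin] euclidean_representation flip: scaleR_sum_left)
  moreover have "(\<Sum>a\<in>Basis. \<Sum>b\<in>Basis. ((k x (w 0) \<bullet> b) * (d\<xi> b \<bullet> a)) *\<^sub>R a) = d\<xi> (k x (w 0))"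
    by (simp add: linear_expand_inner[OF d\<xi>] euclidean_representation flip: scaleR_sum_left)
  moreover have "(\<Sum>a\<in>Basis. \<Sum>b\<in>Basis. ((d\<xi> (w 0) \<bullet> a) * (k x a \<bullet> b)) *\<^sub>R b) = k x (d\<xi> (w 0))"
    by (subst sum.swap) (simp add: linear_expand_inner[OF lin] euclidean_representation flip: scaleR_sum_left)
  ultimately show ?thesis
    unfolding lie_vform_def fn_bracket_def term1 by (simp add: sum.distrib sum_subtractf)
qed

text \<open>This is the classical expression [Ku, Lw] + [Lu, Kw] - K([Lu, w] + [u, Lw]) - L([Ku, w]
  + [u, Kw]) evaluated on constant fields u and w.\<close>

lemma fn_bracket_1_1:
  assumes "one_vform K k x dk" "one_vform L l x dl"
  shows "fn_bracket 1 1 K L x w =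
    dl (k x (w 0)) (w 1) - dl (k x (w 1)) (w 0) - dk (l x (w 1)) (w 0) + dk (l x (w 0)) (w 1)
    - l x (dk (w 0) (w 1) - dk (w 1) (w 0)) - k x (dl (w 0) (w 1) - dl (w 1) (w 0))"
proof -
  interpret K: one_vform K k x dk by fact
  interpret L: one_vform L l x dl by fact
  have dk_lin: "linear (\<lambda>h. dk h u)" for u using K.deriv has_derivative_linear by blast
  have dl_lin: "linear (\<lambda>h. dl h u)" for u using L.deriv has_derivative_linear by blast
  note two = one_add_one[where 'a=nat]
  have term1: "fn_decomposable 1 1 (\<lambda>x w. K x w \<bullet> a) (\<lambda>_. a) (\<lambda>x w. L x w \<bullet> b) (\<lambda>_. b) x w =
    ((k x (w 0) \<bullet> a) * (dl a (w 1) \<bullet> b)) *\<^sub>R b - ((k x (w 1) \<bullet> a) * (dl a (w 0) \<bullet> b)) *\<^sub>R b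
    - ((l x (w 1) \<bullet> b) * (dk b (w 0) \<bullet> a)) *\<^sub>R a + ((l x (w 0) \<bullet> b) * (dk b (w 1) \<bullet> a)) *\<^sub>R a
    - (((dk (w 0) (w 1) - dk (w 1) (w 0)) \<bullet> a) * (l x a \<bullet> b)) *\<^sub>R b
    - (((dl (w 0) (w 1) - dl (w 1) (w 0)) \<bullet> b) * (k x b \<bullet> a)) *\<^sub>R a" for a b
  proof -
    have w1: "wedge 1 1 (\<lambda>x w. K x w \<bullet> a) (lie_form 1 (\<lambda>_. a) (\<lambda>x w. L x w \<bullet> b)) x w =
        (k x (w 0) \<bullet> a) * (dl a (w 1) \<bullet> b) - (k x (w 1) \<bullet> a) * (dl a (w 0) \<bullet> b)"
      by (simp add: wedge_degree_2 L.lie_form_1[unfolded One_nat_def] K.one)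
    have w2: "wedge 1 1 (lie_form 1 (\<lambda>_. b) (\<lambda>x w. K x w \<bullet> a)) (\<lambda>x w. L x w \<bullet> b) x w =
        (l x (w 1) \<bullet> b) * (dk b (w 0) \<bullet> a) - (l x (w 0) \<bullet> b) * (dk b (w 1) \<bullet> a)"
      by (simp add: wedge_degree_2 K.lie_form_1[unfolded One_nat_def] L.one)
    have w3: "wedge 2 0 (ext_d 1 (\<lambda>x w. K x w \<bullet> a)) (contract 1 (\<lambda>_. a) (\<lambda>x w. L x w \<bullet> b)) x w =
        ((dk (w 0) (w 1) - dk (w 1) (w 0)) \<bullet> a) * (l x a \<bullet> b)"
      by (simp add: wedge_degree_2 contract_def L.one K.ext_d_1[unfolded One_nat_def] inner_diff_left field_simps)
    have w4: "wedge 0 2 (contract 1 (\<lambda>_. b) (\<lambda>x w. K x w \<bullet> a)) (ext_d 1 (\<lambda>x w. L x w \<bullet> b)) x w =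
        ((dl (w 0) (w 1) - dl (w 1) (w 0)) \<bullet> b) * (k x b \<bullet> a)"
      by (simp add: wedge_degree_2 contract_def K.one L.ext_d_1[unfolded One_nat_def] inner_diff_left field_simps)
    show ?thesis
      unfolding fn_decomposable_def w1 w2 two w3 w4 diff_self_eq_0
      by (simp add: lie_bracket_def algebra_simps)
  qed
  have 1: "(\<Sum>a\<in>Basis. \<Sum>b\<in>Basis. ((y \<bullet> a) * (M a \<bullet> b)) *\<^sub>R b) = M y"
    if "linear M" for M :: "'a \<Rightarrow> 'a" and y
    by (subst sum.swap) (simp add: linear_expand_inner[OF that] euclidean_representation flip: scaleR_sum_left)
  have 2: "(\<Sum>a\<in>Basis. \<Sum>b\<in>Basis. ((y \<bullet> b) * (M b \<bullet> a)) *\<^sub>R a) = M y"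
    if "linear M" for M :: "'a \<Rightarrow> 'a" and y
    by (simp add: linear_expand_inner[OF that] euclidean_representation flip: scaleR_sum_left)
  show ?thesis
    unfolding fn_bracket_def term1
    by (simp only: sum.distrib sum_subtractf 1[OF dl_lin] 2[OF dk_lin] 1[OF L.lin] 2[OF K.lin])
qed

section \<open>A second order connection in a fibred chart\<close>

text \<open>Together with \<open>*v\<close>, these bilinear products absorb the index sums of the
  coordinate formulas, so that linearity and derivatives come from general facts on bounded bilinear
  maps.\<close>

definition act :: "real^'n^'n^'m \<Rightarrow> real^'n \<Rightarrow> real^'n^'m" where
  "act A a = (\<chi> \<sigma> j. \<Sum>i\<in>UNIV. A $ \<sigma> $ i $ j * a $ i)"

definition outer :: "real^'n \<Rightarrow> real^'m \<Rightarrow> real^'n^'m" where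
  "outer a t = (\<chi> \<sigma> i. a $ i * t $ \<sigma>)"

lemma bounded_bilinear_act: "bounded_bilinear act"
  unfolding bilinear_conv_bounded_bilinear[symmetric] bilinear_def
  by (auto intro!: linearI simp: act_def vec_eq_iff sum.distrib algebra_simps sum_distrib_left)

lemma bounded_bilinear_outer: "bounded_bilinear outer"
  unfolding bilinear_conv_bounded_bilinear[symmetric] bilinear_def
  by (auto intro!: linearI simp: outer_def vec_eq_iff algebra_simps)

lemma bounded_bilinear_mv: "bounded_bilinear ((*v) :: real^'n^'m \<Rightarrow> real^'n \<Rightarrow> real^'m)"
  unfolding bilinear_conv_bounded_bilinear[symmetric] bilinear_def
  by (auto intro!: linearI simp: matrix_vector_mult_def vec_eq_iff sum.distrib algebra_simps sum_distrib_left)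

interpretation act: bounded_bilinear act by (rule bounded_bilinear_act)
interpretation outer: bounded_bilinear outer by (rule bounded_bilinear_outer)
interpretation mv: bounded_bilinear "(*v) :: real^'n^'m \<Rightarrow> real^'n \<Rightarrow> real^'m"
  by (rule bounded_bilinear_mv)

lemmas bilin_simps =
  act.add_left act.add_right act.diff_left act.diff_right act.minus_left act.minus_right
  act.scaleR_left act.scaleR_right act.zero_left act.zero_right
  outer.add_left outer.add_right outer.diff_left outer.diff_right outer.minus_left outer.minus_right
  outer.scaleR_left outer.scaleR_right outer.zero_left outer.zero_right
  mv.add_left mv.add_right mv.diff_left mv.diff_right mv.minus_left mv.minus_right
  mv.scaleR_left mv.scaleR_right mv.zero_left mv.zero_right

lemma outer_mv: "outer a t *v b = (a \<bullet> b) *\<^sub>R t"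
  by (simp add: outer_def matrix_vector_mult_def inner_vec_def vec_eq_iff sum_distrib_left mult_ac)

lemma act_mv_commute:
  assumes "\<And>\<sigma> i j. A $ \<sigma> $ i $ j = A $ \<sigma> $ j $ i"
  shows "act A a *v b = act A b *v a"
proof -
  have "(\<Sum>j\<in>UNIV. \<Sum>i\<in>UNIV. b $ j * (a $ i * A $ \<sigma> $ i $ j)) =
      (\<Sum>j\<in>UNIV. \<Sum>i\<in>UNIV. a $ j * (b $ i * A $ \<sigma> $ i $ j))" for \<sigma>
    by (subst sum.swap, intro sum.cong refl) (metis assms mult.left_commute)
  then show ?thesis
    by (simp add: act_def matrix_vector_mult_def vec_eq_iff sum_distrib_left sum_distrib_right mult_ac)
qed

lemma differentiable_bilinear:
  assumes "bounded_bilinear B" "f differentiable (at x)" "g differentiable (at x)"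
  shows "(\<lambda>x. B (f x) (g x)) differentiable (at x)"
  using assms bounded_bilinear.FDERIV unfolding differentiable_def by blast

lemma differentiable_family:
  fixes k :: "'a::euclidean_space \<Rightarrow> 'b::euclidean_space \<Rightarrow> 'c::real_normed_vector"
  assumes "open S" "x \<in> S" "\<And>y. y \<in> S \<Longrightarrow> linear (k y)"
    and "\<And>u. (\<lambda>y. k y u) differentiable (at x)" "f differentiable (at x)"
  shows "(\<lambda>y. k y (f y)) differentiable (at x)"
proof -
  have "((\<lambda>y. k y u) has_derivative (\<lambda>h. frechet_derivative (\<lambda>y. k y u) (at x) h)) (at x)" for u
    using assms(4) by (simp add: frechet_derivative_works)
  moreover obtain f' where "(f has_derivative f') (at x)" using assms(5) differentiable_def by blast
  ultimately show ?thesis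
    using has_derivative_family(1)[where k=k and f=f and f'=f'
        and k'="\<lambda>h u. frechet_derivative (\<lambda>y. k y u) (at x) h", OF assms(1,2,3)]
    unfolding differentiable_def by blast
qed

lemma projectorI:
  assumes "a \<in> A" "w - a \<in> B" "\<And>b. b \<in> A \<Longrightarrow> w - b \<in> B \<Longrightarrow> b = a"
  shows "projector A B w = a"
  unfolding projector_def using assms by blast

lemma span_three: "a \<in> R \<Longrightarrow> b \<in> S \<Longrightarrow> c \<in> T \<Longrightarrow> a + b + c \<in> span (R \<union> S \<union> T)"
  by (intro span_add span_base) auto

text \<open>Serves the uniqueness of projections: a linear map that vanishes on each complementary
  summand sees only the projected part.\<close>

lemma span_kernel: "linear f \<Longrightarrow> (\<And>x. x \<in> A \<Longrightarrow> f x = 0) \<Longrightarrow> x \<in> span A \<Longrightarrow> f x = 0"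
  using linear_eq_0_on_span by blast

section \<open>The four projectors in an arbitrary fibred chart\<close>

text \<open>\<open>J\<close> is the coordinate domain of the first jet bundle over the base domain
  \<open>B\<close>. Differentiability of order two is asked because H contains first derivatives of
  F and \<phi>, and the brackets differentiate the projectors once more.\<close>

locale fibred_chart =
  fixes J :: "('n::finite, 'm::finite) jcoord set" and B :: "(real^'n) set"
    and F :: "('n, 'm) jcoord \<Rightarrow> real^'n^'n^'m" and \<phi> v :: "real^'n \<Rightarrow> real^'n"
  assumes open_J: "open J" and open_B: "open B" and J_B: "\<And>p. p \<in> J \<Longrightarrow> fst p \<in> B"
    and F_smooth: "Ck_on 2 J F" and \<phi>_smooth: "Ck_on 2 B \<phi>" and v_smooth: "Ck_on 2 B v"
    and unit: "\<And>x. x \<in> B \<Longrightarrow> \<phi> x \<bullet> v x = 1"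
    and F_sym: "\<And>p \<sigma> i j. p \<in> J \<Longrightarrow> F p $ \<sigma> $ i $ j = F p $ \<sigma> $ j $ i"
begin

abbreviation "DF p \<equiv> frechet_derivative F (at p)"
abbreviation "D\<phi> x \<equiv> frechet_derivative \<phi> (at x)"
abbreviation "Dv x \<equiv> frechet_derivative v (at x)"

text \<open>\<open>tau\<close> collects the contact forms into one map, \<open>\<phi>_up p\<close>
  is inverse to the fibre part of \<open>s_map\<close> on D_+, and \<open>dG p h w\<close> is the
  derivative of \<open>G p w\<close> in \<open>p\<close> along \<open>h\<close>.\<close>

definition "G p w = (fst w, snd (snd p) *v fst w, act (F p) (fst w))"
  for p w :: "('n, 'm) jcoord"
definition "dG p h w = (0 :: real^'n, snd (snd h) *v fst w, act (DF p h) (fst w))"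
  for p h w :: "('n, 'm) jcoord"
definition "tau p w = fst (snd w) - snd (snd p) *v fst w"
  for p w :: "('n, 'm) jcoord"
definition "\<phi>_up p t = (0 :: real^'n, 0 :: real^'m, outer (\<phi> (fst p)) t)"
  for p :: "('n, 'm) jcoord" and t :: "real^'m"

text \<open>
  In the notation of the paper, \<open>H p t\<close> has the components \<open>H\<^sup>\<nu>\<^sub>\<sigma>\<^sub>k t\<^sup>\<sigma>\<close>, and \<open>q p w\<close> is \<open>v\<^sup>k \<psi>\<^sub>k\<close>
  evaluated at \<open>w\<close>, in a chart that need not be adapted to \<open>\<phi>\<close>; \<open>T\<close> is \<open>Q_tilde\<close>.
  \<open>Hv p t\<close> is \<open>v\<^sup>k H\<^sub>k t\<close>: the eigenvalue equation for \<open>H\<close> determines it by contraction with \<open>v\<close>.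
\<close>

definition "Hv p t = (1/2) *\<^sub>R
  (act (DF p (\<phi>_up p t)) (v (fst p)) *v v (fst p) - (D\<phi> (fst p) (v (fst p)) \<bullet> v (fst p)) *\<^sub>R t)"
definition "H p t = act (DF p (\<phi>_up p t)) (v (fst p))
  - outer (D\<phi> (fst p) (v (fst p))) t - outer (\<phi> (fst p)) (Hv p t)"
definition "q p w = snd (snd w) *v v (fst p) - act (F p) (fst w) *v v (fst p) - Hv p (tau p w)"
definition "P p w = (0 :: real^'n, tau p w, H p (tau p w))"
definition "Q p w = \<phi>_up p (q p w)"
definition "T p w = w - G p w - P p w - Q p w"

lemma F_deriv: "p \<in> J \<Longrightarrow> (F has_derivative DF p) (at p)"
  and F_deriv2: "p \<in> J \<Longrightarrow> (\<lambda>p. DF p u) differentiable (at p)"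
  and \<phi>_deriv: "x \<in> B \<Longrightarrow> (\<phi> has_derivative D\<phi> x) (at x)"
  and \<phi>_deriv2: "x \<in> B \<Longrightarrow> (\<lambda>x. D\<phi> x a) differentiable (at x)"
  and v_deriv: "x \<in> B \<Longrightarrow> (v has_derivative Dv x) (at x)"
  using Ck_on_SucD(1)[OF F_smooth[unfolded numeral_2_eq_2]]
    Ck_on_SucD(1)[OF Ck_on_SucD(2)[OF F_smooth[unfolded numeral_2_eq_2]]]
    Ck_on_SucD(1)[OF \<phi>_smooth[unfolded numeral_2_eq_2]]
    Ck_on_SucD(1)[OF Ck_on_SucD(2)[OF \<phi>_smooth[unfolded numeral_2_eq_2]]]
    Ck_on_SucD(1)[OF v_smooth[unfolded numeral_2_eq_2]]
  by (simp_all add: frechet_derivative_works)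

lemma DF_linear: "p \<in> J \<Longrightarrow> linear (DF p)"
  using F_deriv has_derivative_linear by blast

lemma D\<phi>_linear: "x \<in> B \<Longrightarrow> linear (D\<phi> x)"
  using \<phi>_deriv has_derivative_linear by blast

lemma Dv_linear: "x \<in> B \<Longrightarrow> linear (Dv x)"
  using v_deriv has_derivative_linear by blast

lemma \<phi>_fst_deriv: "p \<in> J \<Longrightarrow> ((\<lambda>p. \<phi> (fst p)) has_derivative (\<lambda>h. D\<phi> (fst p) (fst h))) (at p)"
  using diff_chain_at[OF has_derivative_fst[OF has_derivative_ident] \<phi>_deriv[OF J_B]]
  by (simp add: o_def)

lemma v_fst_deriv: "p \<in> J \<Longrightarrow> ((\<lambda>p. v (fst p)) has_derivative (\<lambda>h. Dv (fst p) (fst h))) (at p)"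
  using diff_chain_at[OF has_derivative_fst[OF has_derivative_ident] v_deriv[OF J_B]]
  by (simp add: o_def)

lemma z_deriv: "((\<lambda>p. snd (snd p)) has_derivative (\<lambda>h. snd (snd h))) (at p)"
  by (auto intro!: derivative_eq_intros)

lemma G_linear: "linear (G p)"
  by (rule linearI) (simp_all add: G_def bilin_simps)

lemma tau_linear: "linear (tau p)"
  by (rule linearI) (simp_all add: tau_def bilin_simps algebra_simps)

lemma \<phi>_up_linear: "linear (\<phi>_up p)"
  by (rule linearI) (simp_all add: \<phi>_up_def bilin_simps)

lemma Hv_linear: "p \<in> J \<Longrightarrow> linear (Hv p)"
  by (rule linearI) (simp_all add: Hv_def bilin_simps algebra_simps
      linear_add[OF \<phi>_up_linear] linear_cmul[OF \<phi>_up_linear] linear_add[OF DF_linear] linear_cmul[OF DF_linear])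

lemma H_linear: "p \<in> J \<Longrightarrow> linear (H p)"
  by (rule linearI) (simp_all add: H_def bilin_simps algebra_simps
      linear_add[OF \<phi>_up_linear] linear_cmul[OF \<phi>_up_linear] linear_add[OF DF_linear] linear_cmul[OF DF_linear]
      linear_add[OF Hv_linear] linear_cmul[OF Hv_linear])

lemma q_linear: "p \<in> J \<Longrightarrow> linear (q p)"
  by (rule linearI) (simp_all add: q_def bilin_simps algebra_simps
      linear_add[OF tau_linear] linear_cmul[OF tau_linear] linear_add[OF Hv_linear] linear_cmul[OF Hv_linear])

lemma P_linear: "p \<in> J \<Longrightarrow> linear (P p)"
  by (rule linearI) (simp_all add: P_def linear_add[OF tau_linear] linear_cmul[OF tau_linear]
      linear_add[OF H_linear] linear_cmul[OF H_linear])

lemma Q_linear: "p \<in> J \<Longrightarrow> linear (Q p)"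
  unfolding Q_def using linear_compose[OF q_linear \<phi>_up_linear] by (simp add: o_def)

lemma T_linear: "p \<in> J \<Longrightarrow> linear (T p)"
  unfolding T_def by (intro linear_compose_sub linear_ident G_linear P_linear Q_linear)

lemma unit_J: "p \<in> J \<Longrightarrow> \<phi> (fst p) \<bullet> v (fst p) = 1"
  using unit J_B by blast

lemma outer_\<phi>_mv: "p \<in> J \<Longrightarrow> outer (\<phi> (fst p)) t *v v (fst p) = t"
  by (simp add: outer_mv unit_J)

lemma Hv_0: "p \<in> J \<Longrightarrow> Hv p 0 = 0" and H_0: "p \<in> J \<Longrightarrow> H p 0 = 0"
  using linear_0[OF Hv_linear] linear_0[OF H_linear] by auto

text \<open>In the contraction of \<open>H p t\<close> with v, the first two terms add up to twice
  \<open>Hv p t\<close>, and \<phi>(v) = 1 turns the last one into a single \<open>Hv p t\<close> to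
  be subtracted.\<close>

lemma H_mv: "p \<in> J \<Longrightarrow> H p t *v v (fst p) = Hv p t"
proof -
  assume p: "p \<in> J"
  have "2 *\<^sub>R Hv p t = act (DF p (\<phi>_up p t)) (v (fst p)) *v v (fst p) - (D\<phi> (fst p) (v (fst p)) \<bullet> v (fst p)) *\<^sub>R t"
    by (simp add: Hv_def)
  then show "H p t *v v (fst p) = Hv p t"
    unfolding H_def mv.diff_left outer_mv unit_J[OF p] scaleR_2 by (simp add: algebra_simps)
qed

lemma tau_G: "tau p (G p w) = 0"
  by (simp add: tau_def G_def)

text \<open>The first of four facts by which \<open>Q\<close> is the projector onto D_+ along the
  other summands: \<open>q\<close> vanishes on D_\<Gamma>, on H and on vertical vectors annihilated
  by v, and it inverts \<open>\<phi>_up\<close>.\<close>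

lemma q_G: "p \<in> J \<Longrightarrow> q p (G p w) = 0"
  by (simp add: q_def tau_G Hv_0) (simp add: G_def)

lemma q_vertical: "p \<in> J \<Longrightarrow> q p (0, 0, \<psi>) = \<psi> *v v (fst p)"
  by (simp add: q_def tau_def Hv_0 bilin_simps)

lemma q_\<phi>_up: "p \<in> J \<Longrightarrow> q p (\<phi>_up p t) = t"
  by (simp add: \<phi>_up_def q_vertical outer_\<phi>_mv)

lemma q_P: "p \<in> J \<Longrightarrow> q p (P p w) = 0"
  by (simp add: q_def P_def tau_def H_mv bilin_simps)

lemma q_Q: "p \<in> J \<Longrightarrow> q p (Q p w) = q p w"
  by (simp add: Q_def q_\<phi>_up)

lemma G_proj_eq: "G_proj F p w = G p (w 0)"
proof -
  have delta: "(\<Sum>j\<in>UNIV. axis j 1 $ i * a $ j) = a $ i" for a :: "real^'n" and i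
    by (simp add: axis_def if_distribR if_distrib[of "\<lambda>x. x * _"] cong: if_cong)
  show ?thesis
    by (simp add: delta G_proj_def G_def Gamma_field_def prod_eq_iff fst_sum snd_sum vec_eq_iff act_def
        matrix_vector_mult_def mult_ac)
qed

lemma Gamma_v_eq: "Gamma_v F v p = G p (v (fst p), 0)"
  using G_proj_eq[of p "\<lambda>_. (v (fst p), 0)"] unfolding Gamma_v_def G_proj_def fst_conv .

lemma D_Gamma_eq: "D_Gamma F p = range (G p)"
proof
  have "Gamma_field F i p = G p (axis i 1, 0)" for i
    by (simp add: Gamma_field_def G_def vec_eq_iff act_def matrix_vector_mult_def axis_def if_distrib cong: if_cong)
  moreover have "subspace (range (G p))"
    using linear_subspace_image[OF G_linear subspace_UNIV] .
  ultimately show "D_Gamma F p \<subseteq> range (G p)"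
    unfolding D_Gamma_def by (intro span_minimal) auto
  have "G p w \<in> D_Gamma F p" for w
    using G_proj_eq[of p "\<lambda>_. w"] unfolding G_proj_def D_Gamma_def
    by (metis (no_types, lifting) rangeI span_base span_scale span_sum)
  then show "range (G p) \<subseteq> D_Gamma F p" by auto
qed

lemma G_deriv: "p \<in> J \<Longrightarrow> ((\<lambda>p. G p w) has_derivative (\<lambda>h. dG p h w)) (at p)"
  unfolding G_def dG_def
  by (intro has_derivative_Pair has_derivative_const z_deriv F_deriv
      bounded_linear.has_derivative[OF mv.bounded_linear_left]
      bounded_linear.has_derivative[OF act.bounded_linear_left])

lemma one_vform_G: "p \<in> J \<Longrightarrow> one_vform (G_proj F) G p (dG p)"
  by (intro one_vform.intro G_linear G_deriv) (simp_all add: fun_eq_iff G_proj_eq)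

subsection \<open>The eigenspaces and the projectors\<close>

text \<open>The derivatives of v drop out: after D\<Gamma>_v they appear inside a lift, on which the
  contact forms vanish, and before D\<Gamma>_v the values of S have no base component. Symmetry of F
  brings the remaining F term into the shape in which it occurs in \<open>q\<close>.\<close>

lemma lie_S_eq:
  assumes p: "p \<in> J"
  shows "lie_S F \<phi> v p w = (0, - tau p (w 0),
    outer (D\<phi> (fst p) (v (fst p))) (tau p (w 0))
      + outer (\<phi> (fst p)) (snd (snd (w 0)) *v v (fst p) - act (F p) (fst (w 0)) *v v (fst p))
      - act (DF p (\<phi>_up p (tau p (w 0)))) (v (fst p)))"
proof -
  define ds where "ds hh w = (0 :: real^'n, 0 :: real^'m,
      outer (D\<phi> (fst p) (fst hh)) (tau p w) - outer (\<phi> (fst p)) (snd (snd hh) *v fst w))" for hh w :: "('n, 'm) jcoord"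
  define d\<Gamma> where "d\<Gamma> hh = (Dv (fst p) (fst hh), snd (snd p) *v Dv (fst p) (fst hh) + snd (snd hh) *v v (fst p),
      act (F p) (Dv (fst p) (fst hh)) + act (DF p hh) (v (fst p)))" for hh
  have "((\<lambda>p. \<phi>_up p (tau p w)) has_derivative (\<lambda>h. ds h w)) (at p)" for w
    unfolding \<phi>_up_def tau_def ds_def
    by (auto intro!: derivative_eq_intros has_derivative_Pair outer.FDERIV mv.FDERIV \<phi>_fst_deriv[OF p] z_deriv
        simp: bilin_simps)
  moreover have "S_form \<phi> = (\<lambda>p w. \<phi>_up p (tau p (w 0)))"
    by (simp add: fun_eq_iff S_form_def \<phi>_up_def contact_def tau_def outer_def vec_eq_iff matrix_vector_mult_def)
  ultimately have s: "one_vform (S_form \<phi>) (\<lambda>p w. \<phi>_up p (tau p w)) p ds"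
    using linear_compose[OF tau_linear \<phi>_up_linear] by (intro one_vform.intro) (simp_all add: o_def)
  have "Gamma_v F v = (\<lambda>p. (v (fst p), snd (snd p) *v v (fst p), act (F p) (v (fst p))))"
    by (simp add: fun_eq_iff Gamma_v_eq G_def)
  then have g: "(Gamma_v F v has_derivative d\<Gamma>) (at p)"
    unfolding d\<Gamma>_def
    by (simp only:) (intro has_derivative_Pair act.FDERIV mv.FDERIV v_fst_deriv[OF p] z_deriv F_deriv[OF p])
  have c: "act (F p) a *v b = act (F p) b *v a" for a b by (rule act_mv_commute[OF F_sym[OF p]])
  show ?thesis
    unfolding lie_S_def lie_vform_1[OF s g]
    by (simp add: ds_def d\<Gamma>_def Gamma_v_eq G_def c[of "v (fst p)"] \<phi>_up_def[of p "tau p w" for w] tau_def bilin_simps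
       linear_0[OF Dv_linear[OF J_B[OF p]]] outer_\<phi>_mv[OF p])
      (simp add: \<phi>_up_def outer_mv unit_J[OF p] bilin_simps algebra_simps
       linear_0[OF Dv_linear[OF J_B[OF p]]])
qed

text \<open>The eigenvalue equation expresses \<psi> through its own contraction with v. Contracting
  once more and using \<phi>(v) = 1 puts this unknown on both sides with opposite signs, whence the
  factor 1/2 in \<open>Hv\<close>; inserting the solution gives \<psi> =
  \<open>H p t\<close>.\<close>

lemma H_dist_eq: assumes p: "p \<in> J" shows "H_dist F \<phi> v p = {(0, t, H p t) | t. True}"
proof (intro set_eqI iffI)
  fix w assume "w \<in> H_dist F \<phi> v p"
  then have e: "lie_S F \<phi> v p (\<lambda>_. w) = - w" by (simp add: H_dist_def eigenspace_def)
  obtain a t \<psi> where w: "w = (a, t, \<psi>)" by (cases w)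
  have a: "a = 0" using e by (simp add: lie_S_eq[OF p] w)
  have t: "tau p w = t" by (simp add: w a tau_def bilin_simps)
  have e3: "\<psi> = act (DF p (\<phi>_up p t)) (v (fst p)) - outer (D\<phi> (fst p) (v (fst p))) t
      - outer (\<phi> (fst p)) (\<psi> *v v (fst p))"
    using e unfolding lie_S_eq[OF p] t by (simp add: w a bilin_simps algebra_simps)
  then have "\<psi> *v v (fst p) = act (DF p (\<phi>_up p t)) (v (fst p)) *v v (fst p)
     - (D\<phi> (fst p) (v (fst p)) \<bullet> v (fst p)) *\<^sub>R t - \<psi> *v v (fst p)"
    by (metis mv.diff_left outer_mv unit_J[OF p] scaleR_one)
  then have "2 *\<^sub>R (\<psi> *v v (fst p)) = act (DF p (\<phi>_up p t)) (v (fst p)) *v v (fst p)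
     - (D\<phi> (fst p) (v (fst p)) \<bullet> v (fst p)) *\<^sub>R t"
    by (simp add: scaleR_2 algebra_simps)
  then have "Hv p t = \<psi> *v v (fst p)" unfolding Hv_def by (metis scaleR_half_double scaleR_2)
  with e3 have "\<psi> = H p t" by (simp add: H_def)
  then show "w \<in> {(0, t, H p t) | t. True}" by (simp add: w a)
next
  fix w :: "('n, 'm) jcoord"
  assume "w \<in> {(0, t, H p t) | t. True}"
  then obtain t where w: "w = (0, t, H p t)" by auto
  have t: "tau p w = t" by (simp add: w tau_def bilin_simps)
  show "w \<in> H_dist F \<phi> v p"
    unfolding H_dist_def eigenspace_def
    by (simp add: lie_S_eq[OF p] t) (simp add: w H_mv[OF p] bilin_simps, simp add: H_def)
qed

text \<open>The y-component of the operator is - \<open>tau\<close>, so the eigenvalue 1 forces the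
  contact part to vanish. The rest of the equation says that \<psi> is the product of \<phi> with
  its own contraction with v.\<close>

lemma D_plus_eq: assumes p: "p \<in> J" shows "D_plus F \<phi> v p = range (\<phi>_up p)"
proof (intro set_eqI iffI)
  fix w assume "w \<in> D_plus F \<phi> v p"
  then have e: "lie_S F \<phi> v p (\<lambda>_. w) = w" by (simp add: D_plus_def eigenspace_def)
  obtain a t \<psi> where w: "w = (a, t, \<psi>)" by (cases w)
  have a: "a = 0" using e by (simp add: lie_S_eq[OF p] w)
  have "- t = t" using e by (simp add: lie_S_eq[OF p] w a tau_def bilin_simps)
  then have t: "t = 0" by (metis add.right_inverse scaleR_2 scaleR_eq_0_iff zero_neq_numeral)
  have "\<psi> = outer (\<phi> (fst p)) (\<psi> *v v (fst p))"
    using e by (simp add: lie_S_eq[OF p] w a t tau_def bilin_simps linear_0[OF \<phi>_up_linear] linear_0[OF DF_linear[OF p]])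
  then show "w \<in> range (\<phi>_up p)" by (metis a t w \<phi>_up_def rangeI)
next
  fix w assume "w \<in> range (\<phi>_up p)"
  then obtain t where w: "w = \<phi>_up p t" by auto
  have t: "tau p w = 0" by (simp add: w \<phi>_up_def tau_def bilin_simps)
  show "w \<in> D_plus F \<phi> v p"
    unfolding D_plus_def eigenspace_def
    by (simp add: lie_S_eq[OF p] t bilin_simps linear_0[OF \<phi>_up_linear] linear_0[OF DF_linear[OF p]])
      (simp add: w \<phi>_up_def outer_\<phi>_mv[OF p] bilin_simps)
qed

lemma D_zero_vert_eq:
  assumes p: "p \<in> J"
  shows "D_zero_vert F \<phi> v p = {(0, 0, \<psi>) | \<psi>. \<psi> *v v (fst p) = 0}"
proof -
  have "lie_S F \<phi> v p (\<lambda>_. (0, 0, \<psi>)) = \<phi>_up p (\<psi> *v v (fst p))" for \<psi>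
    by (simp add: lie_S_eq[OF p] tau_def bilin_simps linear_0[OF \<phi>_up_linear] linear_0[OF DF_linear[OF p]])
      (simp add: \<phi>_up_def)
  moreover have "\<phi>_up p t = 0 \<longleftrightarrow> t = 0" for t
    using q_\<phi>_up[OF p, of t] linear_0[OF \<phi>_up_linear] linear_0[OF q_linear[OF p]] by metis
  ultimately show ?thesis
    unfolding D_zero_vert_def eigenspace_def vertical10_def by auto
qed

lemma G_mem: "G p w \<in> D_Gamma F p"
  by (simp add: D_Gamma_eq)

lemma P_mem: "p \<in> J \<Longrightarrow> P p w \<in> H_dist F \<phi> v p"
  by (auto simp: H_dist_eq P_def)

lemma Q_mem: "p \<in> J \<Longrightarrow> Q p w \<in> D_plus F \<phi> v p"
  by (auto simp: D_plus_eq Q_def)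

lemma T_eq: "T p w = (0, 0, snd (snd w) - act (F p) (fst w) - H p (tau p w) - outer (\<phi> (fst p)) (q p w))"
  by (simp add: T_def G_def P_def Q_def \<phi>_up_def prod_eq_iff) (simp add: tau_def)

lemma T_mem: "p \<in> J \<Longrightarrow> T p w \<in> D_zero_vert F \<phi> v p"
  by (auto simp: D_zero_vert_eq T_eq bilin_simps outer_\<phi>_mv H_mv) (simp add: q_def)

text \<open>Existence is the decomposition of a vector into its \<open>G\<close>, \<open>P\<close>,
  \<open>T\<close> and \<open>Q\<close> parts. Uniqueness holds because \<open>tau\<close>
  annihilates the other three summands and is injective on H; for \<open>Q_plus\<close> the map
  \<open>q\<close> has this role.\<close>

lemma P_proj_eq:
  assumes p: "p \<in> J" shows "P_proj F \<phi> v p w = P p (w 0)"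
  unfolding P_proj_def
proof (rule projectorI)
  show "P p (w 0) \<in> H_dist F \<phi> v p" by (rule P_mem[OF p])
  have "w 0 - P p (w 0) = G p (w 0) + T p (w 0) + Q p (w 0)"
    by (simp add: T_def)
  then show "w 0 - P p (w 0) \<in> span (D_Gamma F p \<union> D_zero_vert F \<phi> v p \<union> D_plus F \<phi> v p)"
    using span_three[OF G_mem T_mem[OF p] Q_mem[OF p]] by metis
  fix b assume b: "b \<in> H_dist F \<phi> v p"
    and s: "w 0 - b \<in> span (D_Gamma F p \<union> D_zero_vert F \<phi> v p \<union> D_plus F \<phi> v p)"
  have "tau p (w 0 - b) = 0"
    by (rule span_kernel[OF tau_linear _ s])
      (auto simp: D_Gamma_eq tau_G D_zero_vert_eq[OF p] D_plus_eq[OF p] \<phi>_up_def, auto simp: tau_def bilin_simps)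
  moreover obtain t where "b = (0, t, H p t)" using b by (auto simp: H_dist_eq[OF p])
  ultimately show "b = P p (w 0)" by (auto simp: P_def linear_diff[OF tau_linear]) (auto simp: tau_def bilin_simps)
qed

lemma Q_plus_eq:
  assumes p: "p \<in> J" shows "Q_plus F \<phi> v p w = Q p (w 0)"
  unfolding Q_plus_def
proof (rule projectorI)
  show "Q p (w 0) \<in> D_plus F \<phi> v p" by (rule Q_mem[OF p])
  have "w 0 - Q p (w 0) = G p (w 0) + P p (w 0) + T p (w 0)"
    by (simp add: T_def)
  then show "w 0 - Q p (w 0) \<in> span (D_Gamma F p \<union> H_dist F \<phi> v p \<union> D_zero_vert F \<phi> v p)"
    using span_three[OF G_mem P_mem[OF p] T_mem[OF p]] by metis
  fix b assume b: "b \<in> D_plus F \<phi> v p"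
    and s: "w 0 - b \<in> span (D_Gamma F p \<union> H_dist F \<phi> v p \<union> D_zero_vert F \<phi> v p)"
  have "q p (0, t, H p t) = 0" for t
    by (simp add: q_def tau_def H_mv[OF p] bilin_simps)
  then have "q p (w 0 - b) = 0"
    by (intro span_kernel[OF q_linear[OF p] _ s])
      (auto simp: D_Gamma_eq q_G[OF p] D_zero_vert_eq[OF p] H_dist_eq[OF p] q_vertical[OF p])
  moreover obtain t where "b = \<phi>_up p t" using b by (auto simp: D_plus_eq[OF p])
  ultimately show "b = Q p (w 0)" by (simp add: Q_def linear_diff[OF q_linear[OF p]] q_\<phi>_up[OF p])
qed

text \<open>Uniqueness is detected by \<open>T\<close> itself, which annihilates D_\<Gamma>, H and
  D_+ and fixes the vertical vectors annihilated by v.\<close>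

lemma Q_tilde_eq:
  assumes p: "p \<in> J" shows "Q_tilde F \<phi> v p w = T p (w 0)"
  unfolding Q_tilde_def
proof (rule projectorI)
  show "T p (w 0) \<in> D_zero_vert F \<phi> v p" by (rule T_mem[OF p])
  have "w 0 - T p (w 0) = G p (w 0) + P p (w 0) + Q p (w 0)"
    by (simp add: T_def)
  then show "w 0 - T p (w 0) \<in> span (D_Gamma F p \<union> H_dist F \<phi> v p \<union> D_plus F \<phi> v p)"
    using span_three[OF G_mem P_mem[OF p] Q_mem[OF p]] by metis
  fix b assume b: "b \<in> D_zero_vert F \<phi> v p"
    and s: "w 0 - b \<in> span (D_Gamma F p \<union> H_dist F \<phi> v p \<union> D_plus F \<phi> v p)"
  have "T p (0, t, H p t) = 0" for t
    by (simp add: T_eq q_def tau_def H_mv[OF p] bilin_simps prod_eq_iff)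
  moreover have "T p (\<phi>_up p t) = 0" for t
    by (simp add: T_eq q_\<phi>_up[OF p]) (simp add: \<phi>_up_def tau_def H_0[OF p] bilin_simps prod_eq_iff)
  moreover have "T p (G p u) = 0" for u
    by (simp add: T_eq q_G[OF p] tau_G H_0[OF p] bilin_simps) (simp add: G_def prod_eq_iff)
  ultimately have "T p (w 0 - b) = 0"
    by (intro span_kernel[OF T_linear[OF p] _ s]) (auto simp: D_Gamma_eq D_plus_eq[OF p] H_dist_eq[OF p])
  moreover have "T p b = b"
    using b by (auto simp: D_zero_vert_eq[OF p] T_eq q_vertical[OF p]) (simp add: tau_def H_0[OF p] bilin_simps)
  ultimately show "b = T p (w 0)" by (simp add: linear_diff[OF T_linear[OF p]])
qed

end

context fibred_chart
begin

subsection \<open>Derivatives of the projectors\<close>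

lemma
  assumes p: "p \<in> J"
  shows F_diff: "F differentiable (at p)"
    and \<phi>_fst_diff: "(\<lambda>p. \<phi> (fst p)) differentiable (at p)"
    and v_fst_diff: "(\<lambda>p. v (fst p)) differentiable (at p)"
    and z_diff: "(\<lambda>p. snd (snd p)) differentiable (at p)"
  using F_deriv[OF p] \<phi>_fst_deriv[OF p] v_fst_deriv[OF p] z_deriv[of p] unfolding differentiable_def by blast+

lemma tau_diff: "p \<in> J \<Longrightarrow> (\<lambda>p. tau p w) differentiable (at p)"
  unfolding tau_def
  by (intro differentiable_diff differentiable_const differentiable_bilinear[OF bounded_bilinear_mv] z_diff)

lemma \<phi>_up_diff:
  "p \<in> J \<Longrightarrow> f differentiable (at p) \<Longrightarrow> (\<lambda>p. \<phi>_up p (f p)) differentiable (at p)"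
  unfolding \<phi>_up_def
  by (intro differentiable_Pair differentiable_const differentiable_bilinear[OF bounded_bilinear_outer] \<phi>_fst_diff)

lemma DF_diff:
  "p \<in> J \<Longrightarrow> f differentiable (at p) \<Longrightarrow> (\<lambda>p. DF p (f p)) differentiable (at p)"
  by (rule differentiable_family[OF open_J _ DF_linear F_deriv2])

lemma D\<phi>_v_diff:
  assumes p: "p \<in> J" shows "(\<lambda>p. D\<phi> (fst p) (v (fst p))) differentiable (at p)"
proof -
  have "(\<lambda>x. D\<phi> x (v x)) differentiable (at (fst p))"
    by (rule differentiable_family[OF open_B J_B[OF p] D\<phi>_linear \<phi>_deriv2[OF J_B[OF p]]])
      (use v_deriv[OF J_B[OF p]] in \<open>auto simp: differentiable_def\<close>)
  moreover have "fst differentiable (at p)"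
    using has_derivative_fst[OF has_derivative_ident] unfolding differentiable_def by blast
  ultimately show ?thesis
    using differentiable_chain_at[of fst p "\<lambda>x. D\<phi> x (v x)"] by (simp add: o_def)
qed

lemma Hv_diff:
  "p \<in> J \<Longrightarrow> f differentiable (at p) \<Longrightarrow> (\<lambda>p. Hv p (f p)) differentiable (at p)"
  unfolding Hv_def
  by (intro differentiable_diff differentiable_bilinear[OF bounded_bilinear_scaleR] differentiable_const
      differentiable_bilinear[OF bounded_bilinear_mv] differentiable_bilinear[OF bounded_bilinear_act]
      differentiable_bilinear[OF bounded_bilinear_inner] DF_diff \<phi>_up_diff v_fst_diff D\<phi>_v_diff)

lemma H_diff:
  "p \<in> J \<Longrightarrow> f differentiable (at p) \<Longrightarrow> (\<lambda>p. H p (f p)) differentiable (at p)"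
  unfolding H_def
  by (intro differentiable_diff differentiable_bilinear[OF bounded_bilinear_outer]
      differentiable_bilinear[OF bounded_bilinear_act]
      Hv_diff DF_diff \<phi>_up_diff v_fst_diff \<phi>_fst_diff D\<phi>_v_diff)

lemma q_diff: "p \<in> J \<Longrightarrow> (\<lambda>p. q p w) differentiable (at p)"
  unfolding q_def
  by (intro differentiable_diff differentiable_const differentiable_bilinear[OF bounded_bilinear_mv]
      differentiable_bilinear[OF bounded_bilinear_act] Hv_diff tau_diff v_fst_diff F_diff)

lemma P_diff: "p \<in> J \<Longrightarrow> (\<lambda>p. P p w) differentiable (at p)"
  unfolding P_def by (intro differentiable_Pair differentiable_const H_diff tau_diff)

text \<open>These derivatives stay unexpanded: \<open>dP\<close> cancels against its negative in
  \<open>dT\<close>, and \<open>dq\<close> occurs alike on both sides of the final identity. The 0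
  in \<open>dT\<close> is the derivative of the constant \<open>w\<close>.\<close>

definition "dq p h w = frechet_derivative (\<lambda>p. q p w) (at p) h"
definition "dP p h w = frechet_derivative (\<lambda>p. P p w) (at p) h"
definition "dQ p h w = (0 :: real^'n, 0 :: real^'m,
  outer (\<phi> (fst p)) (dq p h w) + outer (D\<phi> (fst p) (fst h)) (q p w))"
definition "dT p h w = 0 - dG p h w - dP p h w - dQ p h w"

lemma q_deriv: "p \<in> J \<Longrightarrow> ((\<lambda>p. q p w) has_derivative (\<lambda>h. dq p h w)) (at p)"
  using q_diff by (simp add: dq_def frechet_derivative_works)

lemma P_deriv: "p \<in> J \<Longrightarrow> ((\<lambda>p. P p w) has_derivative (\<lambda>h. dP p h w)) (at p)"
  using P_diff by (simp add: dP_def frechet_derivative_works)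

lemma Q_deriv: "p \<in> J \<Longrightarrow> ((\<lambda>p. Q p w) has_derivative (\<lambda>h. dQ p h w)) (at p)"
  unfolding Q_def \<phi>_up_def dQ_def
  by (intro has_derivative_Pair has_derivative_const outer.FDERIV \<phi>_fst_deriv q_deriv)

lemma T_deriv: "p \<in> J \<Longrightarrow> ((\<lambda>p. T p w) has_derivative (\<lambda>h. dT p h w)) (at p)"
  unfolding T_def dT_def
  by (intro has_derivative_diff has_derivative_const G_deriv P_deriv Q_deriv)

text \<open>The closed form \<open>k\<close> is available on \<open>J\<close> only, while
  \<open>one_vform\<close> asks for an equation at all points. So the family is \<open>K\<close>
  itself on constant sequences, and the derivative of \<open>k\<close> is transferred to it through
  the open set \<open>J\<close>.\<close>

lemma one_vform_transform:
  assumes p: "p \<in> J" and K: "\<And>p w. p \<in> J \<Longrightarrow> K p w = k p (w 0)" "\<And>p w. K p w = K p (\<lambda>_. w 0)"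
    and k: "linear (k p)" "\<And>w. ((\<lambda>p. k p w) has_derivative (\<lambda>h. dk h w)) (at p)"
  shows "one_vform K (\<lambda>p u. K p (\<lambda>_. u)) p dk"
proof (rule one_vform.intro)
  show "linear (\<lambda>u. K p (\<lambda>_. u))" using k(1) by (simp add: K(1)[OF p])
  show "((\<lambda>p. K p (\<lambda>_. u)) has_derivative (\<lambda>h. dk h u)) (at p)" for u
    by (rule has_derivative_transform_within_open[OF k(2) open_J p]) (simp add: K(1))
  show "K = (\<lambda>x w. K x (\<lambda>_. w 0))" using K(2) by auto
qed

lemma one_vform_P: "p \<in> J \<Longrightarrow> one_vform (P_proj F \<phi> v) (\<lambda>p u. P_proj F \<phi> v p (\<lambda>_. u)) p (dP p)"
  by (rule one_vform_transform[where k=P]) (simp_all add: P_proj_eq P_linear P_deriv, simp add: P_proj_def)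

lemma one_vform_T: "p \<in> J \<Longrightarrow> one_vform (Q_tilde F \<phi> v) (\<lambda>p u. Q_tilde F \<phi> v p (\<lambda>_. u)) p (dT p)"
  by (rule one_vform_transform[where k=T]) (simp_all add: Q_tilde_eq T_linear T_deriv, simp add: Q_tilde_def)

lemma dG_linear: "p \<in> J \<Longrightarrow> linear (\<lambda>h. dG p h w)"
  by (rule linearI) (simp_all add: dG_def bilin_simps linear_add[OF DF_linear] linear_cmul[OF DF_linear])

text \<open>Obtained by differentiating the identity q(G w) = 0.\<close>

lemma dq_G: assumes p: "p \<in> J" shows "dq p h (G p w) = - q p (dG p h w)"
proof -
  have 1: "((\<lambda>p. q p (G p w)) has_derivative (\<lambda>h. dq p h (G p w) + q p (dG p h w))) (at p)"
    by (rule has_derivative_family(1)[OF open_J p q_linear q_deriv[OF p] G_deriv[OF p]])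
  have 2: "((\<lambda>p. q p (G p w)) has_derivative (\<lambda>h. 0)) (at p)"
    by (rule has_derivative_transform_within_open[OF has_derivative_const open_J p]) (simp add: q_G)
  have "dq p h (G p w) + q p (dG p h w) = 0"
    using fun_cong[OF has_derivative_unique[OF 1 2]] .
  then show ?thesis by (simp add: eq_neg_iff_add_eq_0)
qed

lemma q_dQ: "p \<in> J \<Longrightarrow> q p (dQ p h w) = dq p h w + (D\<phi> (fst p) (fst h) \<bullet> v (fst p)) *\<^sub>R q p w"
  by (simp add: dQ_def q_vertical bilin_simps outer_mv unit_J)

text \<open>
  Since \<open>P + T = id - G - Q\<close> and \<open>Q G = 0\<close>, the two curvatures together only involve \<open>G\<close> and \<open>Q\<close>.
\<close>

lemma q_curvature:
  assumes p: "p \<in> J" and u: "w 0 = G p u"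
    and sym: "dG p (G p u) (w 1) = dG p (G p (w 1)) u"
  shows "q p (fn_bracket 1 1 (G_proj F) (P_proj F \<phi> v) p w + fn_bracket 1 1 (G_proj F) (Q_tilde F \<phi> v) p w) =
    - dq p (w 0) (w 1) - (D\<phi> (fst p) (fst (w 0)) \<bullet> v (fst p)) *\<^sub>R q p (w 1)
    - q p (dG p (w 1 - Q p (w 1)) u)"
proof -
  note ql = linear_add[OF q_linear[OF p]] linear_diff[OF q_linear[OF p]] linear_neg[OF q_linear[OF p]]
    linear_0[OF q_linear[OF p]]
  let ?u = "w 0" and ?w = "w 1"
  have fstG: "dG p h (G p a) = dG p h a" for h a by (simp add: dG_def G_def)
  have qP: "q p (P_proj F \<phi> v p (\<lambda>_. a)) = 0" for a by (simp add: P_proj_eq[OF p] q_P[OF p])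
  have qT: "q p (Q_tilde F \<phi> v p (\<lambda>_. a)) = 0" for a
    by (simp add: Q_tilde_eq[OF p] T_def ql q_P[OF p] q_G[OF p] q_Q[OF p])
  have GG: "G p (G p a) = G p a" for a by (simp add: G_def)
  have PT: "P_proj F \<phi> v p (\<lambda>_. a) + Q_tilde F \<phi> v p (\<lambda>_. a) = a - G p a - Q p a" for a
    by (simp add: P_proj_eq[OF p] Q_tilde_eq[OF p] T_def)
  have Qu: "Q p ?u = 0" by (simp add: Q_def u q_G[OF p] linear_0[OF \<phi>_up_linear])
  have PTu: "P_proj F \<phi> v p (\<lambda>_. ?u) + Q_tilde F \<phi> v p (\<lambda>_. ?u) = 0"
    by (simp add: PT Qu) (simp add: u GG)
  have dPT: "q p (dP p a b) + q p (dT p a b) = - q p (dG p a b) - dq p a b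
      - (D\<phi> (fst p) (fst a) \<bullet> v (fst p)) *\<^sub>R q p b" for a b
    by (simp add: dT_def ql q_dQ[OF p] algebra_simps)
  have dGsum: "q p (dG p (P_proj F \<phi> v p (\<lambda>_. a)) b) + q p (dG p (Q_tilde F \<phi> v p (\<lambda>_. a)) b) =
      q p (dG p (a - G p a - Q p a) b)" for a b
    unfolding PT[symmetric] linear_add[OF dG_linear[OF p]] ql ..
  \<comment> \<open>As \<open>q\<close> kills all values of the projectors onto D_\<Gamma>, H and
    the vertical part of D_0, only bracket terms whose outermost factor is a derivative
    survive.\<close>
  have "q p (fn_bracket 1 1 (G_proj F) (P_proj F \<phi> v) p w + fn_bracket 1 1 (G_proj F) (Q_tilde F \<phi> v) p w) =
      (q p (dP p (G p ?u) ?w) + q p (dT p (G p ?u) ?w)) - (q p (dP p (G p ?w) ?u) + q p (dT p (G p ?w) ?u))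
      - (q p (dG p (P_proj F \<phi> v p (\<lambda>_. ?w)) ?u) + q p (dG p (Q_tilde F \<phi> v p (\<lambda>_. ?w)) ?u))
      + (q p (dG p (P_proj F \<phi> v p (\<lambda>_. ?u)) ?w) + q p (dG p (Q_tilde F \<phi> v p (\<lambda>_. ?u)) ?w))"
    unfolding fn_bracket_1_1[OF one_vform_G[OF p] one_vform_P[OF p]]
      fn_bracket_1_1[OF one_vform_G[OF p] one_vform_T[OF p]]
    by (simp add: ql qP qT q_G[OF p])
  also have "\<dots> = (- q p (dG p ?u ?w) - dq p ?u ?w - (D\<phi> (fst p) (fst ?u) \<bullet> v (fst p)) *\<^sub>R q p ?w)
      - (- q p (dG p (G p ?w) u) - dq p (G p ?w) ?u)
      - q p (dG p (?w - G p ?w - Q p ?w) u)"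
    unfolding dPT dGsum PT[symmetric] PTu
    by (simp add: u GG q_G[OF p] fstG linear_0[OF dG_linear[OF p]] ql)
  also have "dq p (G p ?w) ?u = - q p (dG p (G p ?w) u)"
    by (simp add: u dq_G[OF p])
  \<comment> \<open>The vanishing curvature of \<Gamma> enters here: this summand now cancels the
    contribution of \<open>G p (w 1)\<close> to the last one.\<close>
  also have "dG p ?u ?w = dG p (G p ?w) u" using sym u by simp
  also have "q p (dG p (?w - G p ?w - Q p ?w) u) = q p (dG p (?w - Q p ?w) u) - q p (dG p (G p ?w) u)"
    by (simp add: linear_diff[OF dG_linear[OF p]] ql)
  finally show ?thesis by simp
qed

text \<open>The derivative of \<open>G\<close> along D_+, applied to v, contains the contraction of
  DF from which \<open>Hv\<close> was defined as one half. Its contact part is \<open>t\<close>, for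
  which \<open>q\<close> subtracts one \<open>Hv p t\<close>. This is how the eigenvalue equation of
  H enters the final computation.\<close>

lemma q_dG_\<phi>_up:
  assumes p: "p \<in> J"
  shows "q p (dG p (\<phi>_up p t) (v (fst p), b)) =
    Hv p t + (D\<phi> (fst p) (v (fst p)) \<bullet> v (fst p)) *\<^sub>R t"
proof -
  have "2 *\<^sub>R Hv p t = act (DF p (\<phi>_up p t)) (v (fst p)) *v v (fst p) - (D\<phi> (fst p) (v (fst p)) \<bullet> v (fst p)) *\<^sub>R t"
    by (simp add: Hv_def)
  moreover have "dG p (\<phi>_up p t) (v (fst p), b) = (0, t, act (DF p (\<phi>_up p t)) (v (fst p)))"
    by (simp add: dG_def) (simp add: \<phi>_up_def outer_\<phi>_mv[OF p])
  ultimately show ?thesis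
    by (simp add: q_def tau_def bilin_simps scaleR_2 algebra_simps)
qed

lemma s_map_\<phi>_up: assumes p: "p \<in> J" shows "s_map \<phi> p (\<phi>_up p t) = (0, t)"
proof -
  have "(THE s. \<phi>_up p t = \<phi>_up p s) = t"
    using q_\<phi>_up[OF p] by (intro the_equality) metis+
  then show ?thesis by (simp add: s_map_def \<phi>_up_def outer_def)
qed

end

section \<open>The embedded connection and its shape operator in a chart\<close>

locale embedded_chart = fibred_chart J B F \<phi> v
  for J :: "('n::finite, 'm::finite) jcoord set" and B F \<phi> v +
  fixes V :: "('n, 'm) ycoord set" and Z :: "('n, 'm) ycoord \<Rightarrow> ('n, 'm) jcoord"
  assumes open_V: "open V" and Z_smooth: "Ck_on 2 V Z" and Z_J: "\<And>\<eta>. \<eta> \<in> V \<Longrightarrow> Z \<eta> \<in> J"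
    and Z_fst: "\<And>\<eta>. \<eta> \<in> V \<Longrightarrow> fst (Z \<eta>) = fst \<eta>"
    and Z_snd: "\<And>\<eta>. \<eta> \<in> V \<Longrightarrow> fst (snd (Z \<eta>)) = snd \<eta>"
    and embedded: "\<And>\<eta>. \<eta> \<in> V \<Longrightarrow> frechet_derivative Z (at \<eta>) ` D_Z Z \<eta> \<subseteq> D_Gamma F (Z \<eta>)"
begin

abbreviation "DZ \<eta> \<equiv> frechet_derivative Z (at \<eta>)"
text \<open>Since \<open>Z\<close> is a section, the other two components of its derivative are
  those of the argument; all information is in this last one.\<close>

abbreviation "D\<zeta> \<eta> u \<equiv> snd (snd (DZ \<eta> u))"
definition "D2Z \<eta> u h = frechet_derivative (\<lambda>\<eta>. DZ \<eta> u) (at \<eta>) h"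
definition "lift \<eta> a = (a, snd (snd (Z \<eta>)) *v a)"

lemma Z_deriv: "\<eta> \<in> V \<Longrightarrow> (Z has_derivative DZ \<eta>) (at \<eta>)"
  using Ck_on_SucD(1)[OF Z_smooth[unfolded numeral_2_eq_2]] .

lemma DZ_deriv: "\<eta> \<in> V \<Longrightarrow> ((\<lambda>\<eta>. DZ \<eta> u) has_derivative D2Z \<eta> u) (at \<eta>)"
  unfolding D2Z_def[abs_def] using Ck_on_SucD(1)[OF Ck_on_SucD(2)[OF Z_smooth[unfolded numeral_2_eq_2]]] .

lemma D2Z_sym: "\<eta> \<in> V \<Longrightarrow> D2Z \<eta> u h = D2Z \<eta> h u"
  unfolding D2Z_def using symmetric_second_derivative[OF open_V _ Z_smooth] .

lemma DZ_linear: "\<eta> \<in> V \<Longrightarrow> linear (DZ \<eta>)"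
  using Z_deriv has_derivative_linear by blast

lemma fst_DZ: assumes "\<eta> \<in> V" shows "fst (DZ \<eta> u) = fst u"
proof -
  have 1: "((\<lambda>\<eta>. fst (Z \<eta>)) has_derivative (\<lambda>u. fst (DZ \<eta> u))) (at \<eta>)"
    by (intro has_derivative_fst Z_deriv assms)
  have 2: "((\<lambda>\<eta>. fst (Z \<eta>)) has_derivative fst) (at \<eta>)"
    by (rule has_derivative_transform_within_open[OF has_derivative_fst[OF has_derivative_ident] open_V assms])
      (simp add: Z_fst)
  show ?thesis using fun_cong[OF has_derivative_unique[OF 1 2]] .
qed

lemma fst_snd_DZ: assumes "\<eta> \<in> V" shows "fst (snd (DZ \<eta> u)) = snd u"
proof -
  have 1: "((\<lambda>\<eta>. fst (snd (Z \<eta>))) has_derivative (\<lambda>u. fst (snd (DZ \<eta> u)))) (at \<eta>)"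
    by (intro has_derivative_fst has_derivative_snd Z_deriv assms)
  have 2: "((\<lambda>\<eta>. fst (snd (Z \<eta>))) has_derivative snd) (at \<eta>)"
    by (rule has_derivative_transform_within_open[OF has_derivative_snd[OF has_derivative_ident] open_V assms])
      (simp add: Z_snd)
  show ?thesis using fun_cong[OF has_derivative_unique[OF 1 2]] .
qed

lemma lift_eq: "lift \<eta> a = (\<Sum>i\<in>UNIV. a $ i *\<^sub>R Z_field Z i \<eta>)"
proof -
  have "(\<Sum>j\<in>UNIV. axis j 1 $ i * a $ j) = a $ i" for i
    by (simp add: axis_def if_distribR if_distrib[of "\<lambda>x. x * _"] cong: if_cong)
  then show ?thesis
    by (simp add: lift_def Z_field_def prod_eq_iff fst_sum snd_sum vec_eq_iff matrix_vector_mult_def mult.commute)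
qed

lemma Z_v_eq: "Z_v Z v \<eta> = lift \<eta> (v (fst \<eta>))"
  by (simp add: lift_eq Z_v_def)

text \<open>A vector in D_\<Gamma> is determined by its base component, and TZ preserves that
  component because \<open>Z\<close> is a section.\<close>

lemma DZ_lift: assumes "\<eta> \<in> V" shows "DZ \<eta> (lift \<eta> a) = G (Z \<eta>) (a, 0)"
proof -
  have "lift \<eta> a \<in> D_Z Z \<eta>"
    unfolding lift_eq D_Z_def by (intro span_sum span_scale span_base) auto
  then have "DZ \<eta> (lift \<eta> a) \<in> range (G (Z \<eta>))"
    using embedded[OF assms] by (auto simp: D_Gamma_eq)
  then obtain u where u: "DZ \<eta> (lift \<eta> a) = G (Z \<eta>) u" by auto
  have "fst u = fst (DZ \<eta> (lift \<eta> a))" unfolding u by (simp add: G_def)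
  then have "fst u = a" by (simp add: fst_DZ[OF assms] lift_def)
  then show ?thesis unfolding u by (simp add: G_def)
qed

lemma lift_deriv:
  assumes "\<eta> \<in> V" shows "((\<lambda>\<eta>. lift \<eta> a) has_derivative (\<lambda>h. (0, D\<zeta> \<eta> h *v a))) (at \<eta>)"
  unfolding lift_def
  by (intro has_derivative_Pair has_derivative_const has_derivative_snd Z_deriv assms
      bounded_linear.has_derivative[OF mv.bounded_linear_left])

lemma G_Z_deriv: "\<eta> \<in> V \<Longrightarrow> ((\<lambda>\<eta>. G (Z \<eta>) w) has_derivative (\<lambda>h. dG (Z \<eta>) (DZ \<eta> h) w)) (at \<eta>)"
  using diff_chain_at[OF Z_deriv G_deriv[OF Z_J]] by (simp add: o_def)

text \<open>Obtained by differentiating \<open>DZ_lift\<close> along \<open>h\<close>. The second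
  summand on the left comes from the variation of the lift itself.\<close>

lemma D2Z_lift:
  assumes \<eta>: "\<eta> \<in> V"
  shows "D2Z \<eta> (lift \<eta> a) h + DZ \<eta> (0, D\<zeta> \<eta> h *v a) = dG (Z \<eta>) (DZ \<eta> h) (a, 0)"
proof -
  have 1: "((\<lambda>\<eta>. DZ \<eta> (lift \<eta> a)) has_derivative
      (\<lambda>h. D2Z \<eta> (lift \<eta> a) h + DZ \<eta> (0, D\<zeta> \<eta> h *v a))) (at \<eta>)"
    by (rule has_derivative_family(1)[OF open_V \<eta> DZ_linear])
      (use DZ_deriv[OF \<eta>] lift_deriv[OF \<eta>] in auto)
  have 2: "((\<lambda>\<eta>. DZ \<eta> (lift \<eta> a)) has_derivative (\<lambda>h. dG (Z \<eta>) (DZ \<eta> h) (a, 0))) (at \<eta>)"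
    by (rule has_derivative_transform_within_open[OF G_Z_deriv[OF \<eta>] open_V \<eta>]) (simp add: DZ_lift)
  show ?thesis using fun_cong[OF has_derivative_unique[OF 1 2]] .
qed

text \<open>
  This says that the curvature of \<open>\<Gamma>\<close> vanishes along the image of \<open>Z\<close>.
\<close>

lemma dG_G_sym:
  assumes \<eta>: "\<eta> \<in> V"
  shows "dG (Z \<eta>) (G (Z \<eta>) (a, 0)) (b, 0) = dG (Z \<eta>) (G (Z \<eta>) (b, 0)) (a, 0)"
proof -
  have *: "dG (Z \<eta>) (G (Z \<eta>) (a, 0)) (b, 0) =
      D2Z \<eta> (lift \<eta> b) (lift \<eta> a) + DZ \<eta> (0, act (F (Z \<eta>)) a *v b)" for a b
    using D2Z_lift[OF \<eta>, of b "lift \<eta> a"] by (simp add: DZ_lift[OF \<eta>]) (simp add: G_def)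
  \<comment> \<open>Both summands are symmetric in \<open>a\<close> and \<open>b\<close>: the first
    by equality of mixed derivatives, the second by symmetry of F.\<close>
  show ?thesis
    unfolding * D2Z_sym[OF \<eta>, of "lift \<eta> b"] act_mv_commute[OF F_sym[OF Z_J[OF \<eta>]], of a b] ..
qed

text \<open>The fibre component of A_Z, whose values are vertical.\<close>

definition "\<alpha> \<eta> u = q (Z \<eta>) (DZ \<eta> u)"

lemma Z_phi_Q_plus: "\<eta> \<in> V \<Longrightarrow> Z_phi Z \<phi> (Q_plus F \<phi> v) \<eta> w = (0, \<alpha> \<eta> (w 0))"
  by (simp add: Z_phi_def Q_plus_eq Z_J Q_def s_map_\<phi>_up \<alpha>_def)

lemma q_Z_deriv: "\<eta> \<in> V \<Longrightarrow> ((\<lambda>\<eta>. q (Z \<eta>) w) has_derivative (\<lambda>h. dq (Z \<eta>) (DZ \<eta> h) w)) (at \<eta>)"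
  using diff_chain_at[OF Z_deriv q_deriv[OF Z_J]] by (simp add: o_def)

lemma \<alpha>_linear: "\<eta> \<in> V \<Longrightarrow> linear (\<alpha> \<eta>)"
  unfolding \<alpha>_def[abs_def] using linear_compose[OF DZ_linear q_linear[OF Z_J]] by (simp add: o_def)

lemma \<alpha>_deriv:
  "\<eta> \<in> V \<Longrightarrow> ((\<lambda>\<eta>. \<alpha> \<eta> u) has_derivative
    (\<lambda>h. dq (Z \<eta>) (DZ \<eta> h) (DZ \<eta> u) + q (Z \<eta>) (D2Z \<eta> u h))) (at \<eta>)"
  unfolding \<alpha>_def
  by (rule has_derivative_family(1)[OF open_V _ q_linear[OF Z_J] q_Z_deriv DZ_deriv])

lemma one_vform_shape:
  assumes \<eta>: "\<eta> \<in> V"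
  shows "one_vform (Z_phi Z \<phi> (Q_plus F \<phi> v)) (\<lambda>\<eta> u. Z_phi Z \<phi> (Q_plus F \<phi> v) \<eta> (\<lambda>_. u)) \<eta>
    (\<lambda>h u. (0, dq (Z \<eta>) (DZ \<eta> h) (DZ \<eta> u) + q (Z \<eta>) (D2Z \<eta> u h)))"
proof (rule one_vform.intro)
  show "linear (\<lambda>u. Z_phi Z \<phi> (Q_plus F \<phi> v) \<eta> (\<lambda>_. u))"
    by (rule linearI) (simp_all add: Z_phi_Q_plus[OF \<eta>] linear_add[OF \<alpha>_linear[OF \<eta>]] linear_cmul[OF \<alpha>_linear[OF \<eta>]])
  show "((\<lambda>\<eta>. Z_phi Z \<phi> (Q_plus F \<phi> v) \<eta> (\<lambda>_. u)) has_derivative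
      (\<lambda>h. (0, dq (Z \<eta>) (DZ \<eta> h) (DZ \<eta> u) + q (Z \<eta>) (D2Z \<eta> u h)))) (at \<eta>)" for u
    by (rule has_derivative_transform_within_open[OF
          has_derivative_Pair[OF has_derivative_const \<alpha>_deriv[OF \<eta>]] open_V \<eta>])
      (simp add: Z_phi_Q_plus)
  show "Z_phi Z \<phi> (Q_plus F \<phi> v) = (\<lambda>x w. Z_phi Z \<phi> (Q_plus F \<phi> v) x (\<lambda>_. w 0))"
    by (simp add: fun_eq_iff Z_phi_def Q_plus_def)
qed

lemma Z_v_deriv:
  assumes \<eta>: "\<eta> \<in> V"
  shows "(Z_v Z v has_derivative
    (\<lambda>h. lift \<eta> (Dv (fst \<eta>) (fst h)) + (0, D\<zeta> \<eta> h *v v (fst \<eta>)))) (at \<eta>)"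
proof -
  have B: "fst \<eta> \<in> B" using J_B[OF Z_J[OF \<eta>]] Z_fst[OF \<eta>] by simp
  have v: "((\<lambda>\<eta>. v (fst \<eta>)) has_derivative (\<lambda>h. Dv (fst \<eta>) (fst h))) (at \<eta>)"
    using diff_chain_at[OF has_derivative_fst[OF has_derivative_ident] v_deriv[OF B]]
    by (simp add: o_def)
  have "((\<lambda>\<eta>. lift \<eta> (v (fst \<eta>))) has_derivative
      (\<lambda>h. (Dv (fst \<eta>) (fst h), snd (snd (Z \<eta>)) *v Dv (fst \<eta>) (fst h) + D\<zeta> \<eta> h *v v (fst \<eta>)))) (at \<eta>)"
    unfolding lift_def by (intro has_derivative_Pair mv.FDERIV v has_derivative_snd Z_deriv[OF \<eta>])
  then show ?thesis by (simp add: Z_v_eq[abs_def] lift_def)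
qed

theorem lie_shape_operator:
  assumes \<eta>: "\<eta> \<in> V"
  defines "A \<equiv> Z_phi Z \<phi> (Q_plus F \<phi> v)"
  shows "lie_vform 1 (Z_v Z v) A \<eta> w = - comp_vform A A \<eta> w
    - contract_vform (Z_v Z v)
        (\<lambda>\<eta> w. Z_phi Z \<phi> (Phi_plus F \<phi> v) \<eta> w + Z_phi Z \<phi> (r_plus F \<phi> v) \<eta> w) \<eta> w"
proof -
  define p where "p = Z \<eta>"
  have p: "p \<in> J" and fp: "fst p = fst \<eta>" using Z_J[OF \<eta>] Z_fst[OF \<eta>] by (auto simp: p_def)
  note ql = linear_add[OF q_linear[OF p]] linear_diff[OF q_linear[OF p]] linear_neg[OF q_linear[OF p]]
    linear_0[OF q_linear[OF p]]
  define x where "x = fst \<eta>"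
  define w0 where "w0 = w 0"
  define w1 where "w1 = DZ \<eta> w0"
  \<comment> \<open>A vector over v, so that \<open>G p u\<close> is \<Gamma>_v at
    \<open>p\<close>.\<close>
  define u where "u = (v x, 0 :: real^'m, 0 :: real^'n^'m)"
  define t where "t = q p w1"
  define c where "c = D\<phi> x (v x) \<bullet> v x"
  have t: "\<alpha> \<eta> w0 = t" by (simp add: t_def \<alpha>_def w1_def p_def)
  have DZ_Zv: "DZ \<eta> (Z_v Z v \<eta>) = G p u"
    by (simp add: Z_v_eq DZ_lift[OF \<eta>] p_def u_def x_def zero_prod_def)
  have AA: "comp_vform A A \<eta> w = (0, q p (DZ \<eta> (0, t)))"
    unfolding comp_vform_def A_def Z_phi_Q_plus[OF \<eta>] t[unfolded w0_def] by (simp add: \<alpha>_def p_def)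
  \<comment> \<open>The vector \<open>a\<close> will be Dv applied to the base part of
    \<open>w 0\<close>, which comes from differentiating the components of v in Z_v. TZ maps its
    lift into D_\<Gamma>, where \<open>q\<close> vanishes.\<close>
  have "q p (D2Z \<eta> w0 (Z_v Z v \<eta>) + DZ \<eta> (lift \<eta> a + (0, D\<zeta> \<eta> w0 *v v x))) = q p (dG p w1 u)" for a
  proof -
    have "D2Z \<eta> w0 (Z_v Z v \<eta>) + DZ \<eta> (0, D\<zeta> \<eta> w0 *v v x) = dG p w1 u"
      using D2Z_lift[OF \<eta>, of "v x" w0] D2Z_sym[OF \<eta>]
      by (simp add: Z_v_eq x_def w1_def p_def u_def zero_prod_def)
    then have "D2Z \<eta> w0 (Z_v Z v \<eta>) + DZ \<eta> (lift \<eta> a + (0, D\<zeta> \<eta> w0 *v v x)) = dG p w1 u + G p (a, 0)"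
      by (simp add: linear_add[OF DZ_linear[OF \<eta>]] DZ_lift[OF \<eta>] p_def algebra_simps)
    then show ?thesis by (simp add: ql q_G[OF p])
  qed
  then have *: "q p (D2Z \<eta> w0 (Z_v Z v \<eta>)) + \<alpha> \<eta> (lift \<eta> a + (0, D\<zeta> \<eta> w0 *v v x)) = q p (dG p w1 u)" for a
    by (simp add: \<alpha>_def p_def[symmetric] ql)
  have LA: "lie_vform 1 (Z_v Z v) A \<eta> w =
      (0, dq p (G p u) w1 + q p (dG p w1 u) - D\<zeta> \<eta> (0, t) *v v x)"
    unfolding A_def lie_vform_1[OF one_vform_shape[OF \<eta>] Z_v_deriv[OF \<eta>]] Z_phi_Q_plus[OF \<eta>]
      w0_def[symmetric] t DZ_Zv p_def[symmetric] w1_def[symmetric] x_def[symmetric]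
    using *[of "Dv x (fst w0)", folded w1_def]
    by (simp add: lift_def linear_0[OF Dv_linear[OF J_B[OF p]], unfolded fp, folded x_def] algebra_simps)
  \<comment> \<open>Contraction with Z_v shifts the arguments by one: \<open>w' 0\<close> is the
    image of Z_v and \<open>w' 1\<close> that of \<open>w 0\<close>.\<close>
  define w' where "w' = (\<lambda>k. DZ \<eta> (case_nat (Z_v Z v \<eta>) w k))"
  have w': "w' 0 = G p u" "w' 1 = w1" by (simp_all add: w'_def DZ_Zv w1_def w0_def)
  have sym: "dG p (G p u) (w' 1) = dG p (G p (w' 1)) u"
  proof -
    have *: "dG p (G p a) b = dG p (G p (fst a, 0)) (fst b, 0)" for a b by (simp add: dG_def G_def)
    show ?thesis
      unfolding *[of u] *[of "w' 1"] unfolding p_def by (rule dG_G_sym[OF \<eta>])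
  qed
  have fst_u: "fst (G p u) = v x" by (simp add: G_def u_def)
  have C: "contract_vform (Z_v Z v)
        (\<lambda>\<eta> w. Z_phi Z \<phi> (Phi_plus F \<phi> v) \<eta> w + Z_phi Z \<phi> (r_plus F \<phi> v) \<eta> w) \<eta> w =
      (0, - dq p (G p u) w1 - c *\<^sub>R t - q p (dG p (w1 - Q p w1) u))"
    using q_curvature[OF p w'(1) sym]
    by (simp add: contract_vform_def Z_phi_def Phi_plus_def r_plus_def comp_vform_def Q_plus_eq[OF p] Q_def
        s_map_\<phi>_up[OF p] ql w'(1) w'(2)[unfolded One_nat_def] fst_u fp c_def t_def x_def[symmetric] flip: p_def w'_def)
  have "Q p w1 = \<phi>_up p t" by (simp add: Q_def t_def)
  \<comment> \<open>The multiple \<open>c\<close> of \<open>t\<close> obtained here cancels the one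
    in \<open>C\<close>.\<close>
  then have d: "q p (dG p (w1 - Q p w1) u) = q p (dG p w1 u) - Hv p t - c *\<^sub>R t"
    using q_dG_\<phi>_up[OF p, of t "(0, 0)"]
    by (simp add: linear_diff[OF dG_linear[OF p]] ql u_def fp c_def x_def)
  \<comment> \<open>The contact part of TZ(0, t) is \<open>t\<close>, because \<open>Z\<close> is a
    section. This yields the \<open>Hv p t\<close> that cancels the one in \<open>d\<close>.\<close>
  have e: "q p (DZ \<eta> (0, t)) = D\<zeta> \<eta> (0, t) *v v x - Hv p t"
    by (simp add: q_def tau_def fst_DZ[OF \<eta>] fst_snd_DZ[OF \<eta>] bilin_simps fp x_def)
  show ?thesis
    unfolding LA AA C d e by simp
qed

end

section \<open>Charts and jets\<close>

context
  fixes T :: "'p topology" and c :: "('p, 'e::euclidean_space) chart"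
  assumes chart: "is_chart T c"
begin

lemma chart_openin: "openin T (fst c)" and image_of_open: "open (image_of c)"
  and chart_homeo: "homeomorphic_map (subtopology T (fst c)) (top_of_set (image_of c)) (snd c)"
  using chart by (auto simp: is_chart_def)

lemma chart_topspace: "topspace (subtopology T (fst c)) = fst c"
  using openin_subset[OF chart_openin] by auto

lemma chart_inj: "inj_on (snd c) (fst c)"
  using homeomorphic_imp_injective_map[OF chart_homeo] unfolding chart_topspace .

lemma inv_chart_left: "x \<in> fst c \<Longrightarrow> inv_chart c (snd c x) = x"
  by (simp add: inv_chart_def chart_inj)

lemma inv_chart_right: "\<xi> \<in> image_of c \<Longrightarrow> snd c (inv_chart c \<xi>) = \<xi>"
  by (simp add: inv_chart_def image_of_def f_inv_into_f)

lemma inv_chart_mem: "\<xi> \<in> image_of c \<Longrightarrow> inv_chart c \<xi> \<in> fst c"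
  by (simp add: inv_chart_def image_of_def inv_into_into)

lemma open_chart_image: "openin T W \<Longrightarrow> open (snd c ` (fst c \<inter> W))"
proof -
  assume "openin T W"
  then have "openin (subtopology T (fst c)) (fst c \<inter> W)"
    by (metis Int_commute openin_subtopology_Int)
  then have "openin (top_of_set (image_of c)) (snd c ` (fst c \<inter> W))"
    using homeomorphic_imp_open_map[OF chart_homeo] unfolding open_map_def by blast
  then show ?thesis using image_of_open openin_open_trans by blast
qed

lemma continuous_map_chart: "continuous_map (subtopology T (fst c)) (top_of_set (image_of c)) (snd c)"
  using homeomorphic_imp_continuous_map[OF chart_homeo] .

text \<open>The homeomorphism supplies some continuous inverse; it agrees with
  \<open>inv_chart\<close> on the image of the chart, which is the whole source space of the
  claim.\<close>

lemma continuous_map_inv_chart: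
  "continuous_map (top_of_set (image_of c)) (subtopology T (fst c)) (inv_chart c)"
proof -
  obtain g where g: "homeomorphic_maps (subtopology T (fst c)) (top_of_set (image_of c)) (snd c) g"
    using chart_homeo homeomorphic_map_maps by blast
  have "g \<xi> = inv_chart c \<xi>" if "\<xi> \<in> image_of c" for \<xi>
    using g that inv_chart_left inv_chart_mem inv_chart_right unfolding homeomorphic_maps_def chart_topspace
    by metis
  then show ?thesis
    using g unfolding homeomorphic_maps_def by (metis continuous_map_eq topspace_euclidean_subtopology)
qed

end

lemma Ck_on_of_smooth_on: "smooth_on S f \<Longrightarrow> Ck_on k S f"
  by (simp add: smooth_on_def)

section \<open>Jets and their representatives\<close>

text \<open>A section lies in its own jet class, as \<open>same_jet\<close> is reflexive; hence the
  choice is made from a nonempty set.\<close>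

lemma representative_mem:
  assumes "j \<in> jets X Y \<pi> k"
  shows "representative j \<in> snd j"
proof -
  obtain x \<gamma> where j: "j = jet X Y \<pi> k x \<gamma>" "local_section X Y \<pi> x \<gamma>"
    using assms by (auto simp: jets_def)
  then have "\<gamma> \<in> snd j" by (simp add: jet_def same_jet_def)
  then show ?thesis unfolding representative_def by (rule someI[where P="\<lambda>\<gamma>. \<gamma> \<in> snd j"])
qed

lemma representative_jet:
  assumes "local_section X Y \<pi> x \<gamma>" "x \<in> topspace (mtop X)"
  shows "same_jet X Y k x \<gamma> (representative (jet X Y \<pi> k x \<gamma>))"
  using representative_mem[of "jet X Y \<pi> k x \<gamma>" X Y \<pi> k] assms by (auto simp: jets_def jet_def)

lemma local_section_representative:
  "j \<in> jets X Y \<pi> k \<Longrightarrow> local_section X Y \<pi> (fst j) (representative j)"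
  using representative_mem[of j X Y \<pi> k] by (auto simp: jets_def jet_def)

lemma proj_target: "j \<in> jets X Y \<pi> k \<Longrightarrow> \<pi> (target j) = fst j"
  using local_section_representative[of j X Y \<pi> k] by (auto simp: target_def local_section_def)

section \<open>From jets of sections to data in a fibred chart\<close>

locale manifold_chart =
  fixes X :: "('x, 'n::finite) base" and Y :: "('y, 'n, 'm::finite) total" and \<pi> :: "'y \<Rightarrow> 'x"
    and b :: "('x, real^'n) chart" and c :: "('y, ('n, 'm) ycoord) chart"
  assumes fibred: "fibred_manifold X Y \<pi>" and bc: "(b, c) \<in> fibred_charts X Y \<pi>"
begin

lemma b_chart: "b \<in> charts X" and c_chart: "c \<in> charts Y" and fst_b: "fst b = \<pi> ` fst c"
  and c_over_b: "y \<in> fst c \<Longrightarrow> fst (snd c y) = snd b (\<pi> y)"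
  using bc by (auto simp: fibred_charts_def)

lemma charts_X: "d \<in> charts X \<Longrightarrow> is_chart (mtop X) d" and charts_Y: "e \<in> charts Y \<Longrightarrow> is_chart (mtop Y) e"
  and compatible_X: "d \<in> charts X \<Longrightarrow> d' \<in> charts X \<Longrightarrow> compatible d d'"
  and compatible_Y: "e \<in> charts Y \<Longrightarrow> e' \<in> charts Y \<Longrightarrow> compatible e e'"
  using fibred by (auto simp: fibred_manifold_def smooth_manifold_def)

lemmas b_is_chart = charts_X[OF b_chart] and c_is_chart = charts_Y[OF c_chart]

lemma fst_image_of_c: "\<eta> \<in> image_of c \<Longrightarrow> fst \<eta> \<in> image_of b"
  using c_over_b fst_b by (auto simp: image_of_def)

lemma local_section_smooth:
  assumes "local_section X Y \<pi> x \<gamma>" "x \<in> fst b" "\<gamma> x \<in> fst c"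
  obtains D where "open D" "snd b x \<in> D" "Ck_on k D (coord_rep b c \<gamma>)"
proof -
  obtain W where W: "x \<in> W" "smooth_map X Y W \<gamma>"
    using assms(1) by (auto simp: local_section_def)
  then have oW: "openin (mtop X) W" and cW: "continuous_map (subtopology (mtop X) W) (mtop Y) \<gamma>"
    and s: "smooth_on (snd b ` {x \<in> fst b \<inter> W. \<gamma> x \<in> fst c}) (coord_rep b c \<gamma>)"
    using b_chart c_chart unfolding smooth_map_def by blast+
  have "openin (subtopology (mtop X) W) {x \<in> topspace (subtopology (mtop X) W). \<gamma> x \<in> fst c}"
    using openin_continuous_map_preimage[OF cW chart_openin[OF c_is_chart]] .
  then have o: "openin (mtop X) {x \<in> topspace (subtopology (mtop X) W). \<gamma> x \<in> fst c}"
    using openin_trans_full[OF _ oW] by blast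
  have "{x \<in> fst b \<inter> W. \<gamma> x \<in> fst c} = fst b \<inter> {x \<in> topspace (subtopology (mtop X) W). \<gamma> x \<in> fst c}"
    using openin_subset[OF oW] by auto
  then have "open (snd b ` {x \<in> fst b \<inter> W. \<gamma> x \<in> fst c})"
    using open_chart_image[OF b_is_chart o] by simp
  moreover have "snd b x \<in> snd b ` {x \<in> fst b \<inter> W. \<gamma> x \<in> fst c}" using W(1) assms(2,3) by blast
  ultimately show ?thesis using that[OF _ _ Ck_on_of_smooth_on[OF s]] by simp
qed

abbreviation "J \<equiv> jet1_coords (b, c) ` jet1_domain X Y \<pi> (b, c)"

lemma jet1_coords_fst:
  assumes "j \<in> jets X Y \<pi> k" "target j \<in> fst c"
  shows "fst (jet1_coords (b, c) j) = fst (snd c (target j))"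
    "fst (snd (jet1_coords (b, c) j)) = snd (snd c (target j))"
    "fst j \<in> fst b"
proof -
  have tgt: "\<pi> (target j) = fst j" by (rule proj_target[OF assms(1)])
  show m: "fst j \<in> fst b" using imageI[OF assms(2), of \<pi>] unfolding tgt fst_b .
  show "fst (jet1_coords (b, c) j) = fst (snd c (target j))"
    unfolding c_over_b[OF assms(2)] tgt jet1_coords_def Let_def fst_conv ..
  show "fst (snd (jet1_coords (b, c) j)) = snd (snd c (target j))"
    unfolding jet1_coords_def Let_def fibre_rep_def coord_rep_def fst_conv snd_conv
      inv_chart_left[OF b_is_chart m] target_def ..
qed

lemma partial_snd:
  assumes "local_section X Y \<pi> x \<gamma>" "x \<in> fst b" "\<gamma> x \<in> fst c"
  shows "partial i (\<lambda>\<xi>. snd (coord_rep b c \<gamma> \<xi>)) (snd b x) = snd (partial i (coord_rep b c \<gamma>) (snd b x))"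
proof -
  obtain D where D: "open D" "snd b x \<in> D" "Ck_on (Suc 0) D (coord_rep b c \<gamma>)"
    using local_section_smooth[OF assms] by blast
  show ?thesis
    unfolding partial_def
    by (simp flip: frechet_derivative_at[OF has_derivative_snd[OF Ck_on_SucD(1)[OF D(3,2)]]])
qed

text \<open>The matrix \<open>z\<close> prescribes the first derivative at \<xi>. The section lives
  where the affine map stays inside the image of \<open>c\<close>; in other charts it is the affine
  map between two transition maps, hence smooth.\<close>

lemma affine_section:
  fixes z :: "real^'n^'m"
  assumes \<eta>: "(\<xi>, y) \<in> image_of c"
  defines "aff \<equiv> \<lambda>\<xi>'. (\<xi>', y + z *v (\<xi>' - \<xi>))"
  defines "\<gamma> \<equiv> \<lambda>x. inv_chart c (aff (snd b x))"
  shows "local_section X Y \<pi> (inv_chart b \<xi>) \<gamma>"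
    and "\<exists>D. open D \<and> \<xi> \<in> D \<and> (\<forall>\<xi>'\<in>D. coord_rep b c \<gamma> \<xi>' = aff \<xi>')"
proof -
  define D where "D = image_of b \<inter> aff -` image_of c"
  define W where "W = fst b \<inter> snd b -` D"
  have aff_Ck: "Ck_on k UNIV aff" for k
    unfolding aff_def diff_conv_add_uminus
    by (intro Ck_on_Pair Ck_on_add Ck_on_bounded_linear[OF mv.bounded_linear_right]
        Ck_on_ident Ck_on_const open_UNIV)
  have "continuous_on UNIV aff" using aff_Ck[of 0] by simp
  then have oD: "open D"
    unfolding D_def
    using open_Int[OF image_of_open[OF b_is_chart] open_vimage[OF image_of_open[OF c_is_chart]]] by blast
  have \<xi>b: "\<xi> \<in> image_of b" using fst_image_of_c[OF \<eta>] by simp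
  then have \<xi>D: "\<xi> \<in> D" using \<eta> by (simp add: D_def aff_def)
  have DW: "snd b ` W \<subseteq> D" by (auto simp: W_def)
  have x0: "inv_chart b \<xi> \<in> W"
    using \<xi>D inv_chart_mem[OF b_is_chart \<xi>b] inv_chart_right[OF b_is_chart \<xi>b] by (simp add: W_def)
  have b_cont: "continuous_map (subtopology (mtop X) (fst b)) euclidean (snd b)"
    using continuous_map_chart[OF b_is_chart] by (simp add: continuous_map_in_subtopology)
  have "openin (subtopology (mtop X) (fst b)) {x \<in> topspace (subtopology (mtop X) (fst b)). snd b x \<in> D}"
    using openin_continuous_map_preimage[OF b_cont] oD by simp
  then have oW: "openin (mtop X) W"
    using openin_trans_full[OF _ chart_openin[OF b_is_chart]]
    unfolding chart_topspace[OF b_is_chart] W_def vimage_def Int_def by simp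
  have W_top: "topspace (subtopology (mtop X) W) = W" using openin_subset[OF oW] by auto
  have "continuous_map (subtopology (mtop X) W) euclidean (snd b)"
    using continuous_map_from_subtopology_mono[OF b_cont] by (simp add: W_def)
  then have "continuous_map (subtopology (mtop X) W) euclidean (aff \<circ> snd b)"
    by (rule continuous_map_compose) (simp add: \<open>continuous_on UNIV aff\<close>)
  then have "continuous_map (subtopology (mtop X) W) (top_of_set (image_of c)) (aff \<circ> snd b)"
    unfolding continuous_map_in_subtopology using W_top by (auto simp: W_def D_def)
  from continuous_map_compose[OF this continuous_map_inv_chart[OF c_is_chart]]
  have cont: "continuous_map (subtopology (mtop X) W) (mtop Y) \<gamma>"
    by (simp add: continuous_map_in_subtopology \<gamma>_def o_def)
  have \<gamma>_mem: "\<gamma> x \<in> fst c" "snd c (\<gamma> x) = aff (snd b x)" if "x \<in> W" for x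
    using that inv_chart_mem[OF c_is_chart] inv_chart_right[OF c_is_chart] by (auto simp: W_def D_def \<gamma>_def)
  have sec: "\<pi> (\<gamma> x) = x" if "x \<in> W" for x
  proof -
    have "snd b (\<pi> (\<gamma> x)) = snd b x"
      using c_over_b[OF \<gamma>_mem(1)[OF that]] \<gamma>_mem(2)[OF that] by (simp add: aff_def)
    \<comment> \<open>Equal coordinates give equal points only inside the base domain, and \<pi>
      (\<gamma> x) lies there because a fibred chart has the projection of \<open>fst c\<close> as
      its base domain.\<close>
    moreover have "\<pi> (\<gamma> x) \<in> fst b" "x \<in> fst b" using \<gamma>_mem(1)[OF that] that by (auto simp: fst_b W_def)
    ultimately show ?thesis using chart_inj[OF b_is_chart] by (auto dest: inj_onD)
  qed
  have smooth: "smooth_on (snd d ` {x \<in> fst d \<inter> W. \<gamma> x \<in> fst e}) (coord_rep d e \<gamma>)"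
    if d: "d \<in> charts X" and e: "e \<in> charts Y" for d e
    unfolding smooth_on_def
  proof
    fix k
    let ?U = "{x \<in> fst d \<inter> W. \<gamma> x \<in> fst e}"
    let ?S = "snd d ` ?U"
    have "openin (subtopology (mtop X) W) {x \<in> topspace (subtopology (mtop X) W). \<gamma> x \<in> fst e}"
      using openin_continuous_map_preimage[OF cont chart_openin[OF charts_Y[OF e]]] .
    then have "openin (mtop X) {x \<in> topspace (subtopology (mtop X) W). \<gamma> x \<in> fst e}"
      using openin_trans_full[OF _ oW] by blast
    from open_chart_image[OF charts_X[OF d] this] have oS: "open ?S"
      unfolding W_top Int_def by (simp add: conj_ac)
    have 1: "Ck_on k ?S (coord_rep d b id)"
      using compatible_X[OF d b_chart] unfolding compatible_def
      by (auto intro!: Ck_on_subset[OF Ck_on_of_smooth_on] simp: W_def)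
    have 2: "Ck_on k (snd c ` (fst c \<inter> fst e)) (coord_rep c e id)"
      using compatible_Y[OF c_chart e] unfolding compatible_def by (auto intro: Ck_on_of_smooth_on)
    have 3: "Ck_on k ?S (\<lambda>\<xi>. aff (coord_rep d b id \<xi>))"
      by (rule Ck_on_compose[OF oS _ 1 aff_Ck]) auto
    have eq: "aff (coord_rep d b id (snd d x)) = snd c (\<gamma> x)" if "x \<in> ?U" for x
      using that \<gamma>_mem(2) by (simp add: coord_rep_def inv_chart_left[OF charts_X[OF d]])
    have 4: "Ck_on k ?S (\<lambda>\<xi>. coord_rep c e id (aff (coord_rep d b id \<xi>)))"
      by (rule Ck_on_compose[OF oS _ 3 2]) (use eq \<gamma>_mem(1) in auto)
    show "Ck_on k ?S (coord_rep d e \<gamma>)"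
    proof (rule Ck_on_cong[OF oS _ 4])
      fix \<xi>' assume "\<xi>' \<in> ?S"
      then obtain x where x: "x \<in> ?U" "\<xi>' = snd d x" by auto
      then show "coord_rep c e id (aff (coord_rep d b id \<xi>')) = coord_rep d e \<gamma> \<xi>'"
        using eq[OF x(1)] \<gamma>_mem(1)
        by (simp add: coord_rep_def[of d e] coord_rep_def[of c e] inv_chart_left[OF c_is_chart] inv_chart_left[OF charts_X[OF d]])
    qed
  qed
  show "local_section X Y \<pi> (inv_chart b \<xi>) \<gamma>"
    unfolding local_section_def smooth_map_def using x0 oW cont smooth sec by blast
  have "coord_rep b c \<gamma> \<xi>' = aff \<xi>'" if "\<xi>' \<in> D" for \<xi>'
    using that by (simp add: D_def coord_rep_def \<gamma>_def inv_chart_right[OF b_is_chart] inv_chart_right[OF c_is_chart])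
  then show "\<exists>D. open D \<and> \<xi> \<in> D \<and> (\<forall>\<xi>'\<in>D. coord_rep b c \<gamma> \<xi>' = aff \<xi>')" using oD \<xi>D by blast
qed

lemma J_eq: "J = {p. (fst p, fst (snd p)) \<in> image_of c}"
proof (intro set_eqI iffI)
  fix p assume "p \<in> J"
  then obtain j where "j \<in> jets X Y \<pi> 1" "target j \<in> fst c" "p = jet1_coords (b, c) j"
    by (auto simp: jet1_domain_def)
  then show "p \<in> {p. (fst p, fst (snd p)) \<in> image_of c}"
    using jet1_coords_fst by (auto simp: image_of_def)
next
  fix p :: "('n, 'm) jcoord" assume p: "p \<in> {p. (fst p, fst (snd p)) \<in> image_of c}"
  obtain \<xi> y z where pe: "p = (\<xi>, y, z)" by (cases p)
  with p have \<eta>: "(\<xi>, y) \<in> image_of c" by simp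
  define aff where "aff = (\<lambda>\<xi>'. (\<xi>', y + z *v (\<xi>' - \<xi>)))"
  define \<gamma> where "\<gamma> = (\<lambda>x. inv_chart c (snd b x, y + z *v (snd b x - \<xi>)))"
  define x0 where "x0 = inv_chart b \<xi>"
  note sec = affine_section[OF \<eta>, of z, folded \<gamma>_def x0_def]
  have \<xi>b: "\<xi> \<in> image_of b" using fst_image_of_c[OF \<eta>] by simp
  have x0: "x0 \<in> fst b" "snd b x0 = \<xi>" "x0 \<in> topspace (mtop X)"
    using inv_chart_mem[OF b_is_chart \<xi>b] inv_chart_right[OF b_is_chart \<xi>b]
      openin_subset[OF chart_openin[OF b_is_chart]] by (auto simp: x0_def)
  define j where "j = jet X Y \<pi> 1 x0 \<gamma>"
  have j: "j \<in> jets X Y \<pi> 1" using sec(1) x0(3) by (auto simp: j_def jets_def)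
  have fst_j: "fst j = x0" by (simp add: j_def jet_def)
  \<comment> \<open>The chosen representative may differ from the affine section, but the two share
    the value and the first partial derivatives at \<open>x0\<close>, and these are what the jet
    coordinates read.\<close>
  define r where "r = representative j"
  have r: "same_jet X Y 1 x0 \<gamma> r" using representative_jet[OF sec(1) x0(3)] by (simp add: r_def j_def)
  have \<gamma>x0: "\<gamma> x0 = inv_chart c (\<xi>, y)" by (simp add: \<gamma>_def x0)
  have tgt: "target j = inv_chart c (\<xi>, y)"
    using r by (simp add: target_def fst_j r_def[symmetric] same_jet_def \<gamma>x0)
  then have tc: "target j \<in> fst c" "snd c (target j) = (\<xi>, y)"
    using inv_chart_mem[OF c_is_chart \<eta>] inv_chart_right[OF c_is_chart \<eta>] by auto
  have lr: "local_section X Y \<pi> x0 r" using local_section_representative[OF j] by (simp add: fst_j r_def)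
  have rx0: "r x0 \<in> fst c" using tc(1) by (simp add: target_def fst_j r_def)
  have \<gamma>x0c: "\<gamma> x0 \<in> fst c" using inv_chart_mem[OF c_is_chart \<eta>] \<gamma>x0 by simp
  have pd: "partial i (coord_rep b c r) \<xi> = (axis i 1, z *v axis i 1)" for i
  proof -
    have eq: "\<forall>l. length l \<le> 1 \<longrightarrow> partials l (coord_rep b c \<gamma>) \<xi> = partials l (coord_rep b c r) \<xi>"
      using r x0 b_chart c_chart \<gamma>x0c unfolding same_jet_def by blast
    then have "partial i (coord_rep b c r) \<xi> = partial i (coord_rep b c \<gamma>) \<xi>"
      using spec[OF eq, of "[i]"] by simp
    also obtain D where D: "open D" "\<xi> \<in> D" "\<And>\<xi>'. \<xi>' \<in> D \<Longrightarrow> coord_rep b c \<gamma> \<xi>' = aff \<xi>'"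
      using sec(2) unfolding aff_def by blast
    have "(aff has_derivative (\<lambda>h. (h, z *v h))) (at \<xi>)"
      unfolding aff_def
      by (auto intro!: derivative_eq_intros has_derivative_Pair bounded_linear.has_derivative[OF mv.bounded_linear_right])
    then have d: "(coord_rep b c \<gamma> has_derivative (\<lambda>h. (h, z *v h))) (at \<xi>)"
      by (rule has_derivative_transform_within_open[OF _ D(1,2)]) (simp add: D(3))
    have "partial i (coord_rep b c \<gamma>) \<xi> = (axis i 1, z *v axis i 1)"
      unfolding partial_def by (simp flip: frechet_derivative_at[OF d])
    finally show ?thesis .
  qed
  have "fibre_rep (b, c) j = (\<lambda>\<xi>. snd (coord_rep b c r \<xi>))"
    by (simp add: fibre_rep_def[abs_def] r_def)
  then have "partial i (fibre_rep (b, c) j) \<xi> = z *v axis i 1" for i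
    using partial_snd[OF lr x0(1) rx0, of i] pd[of i] by (simp add: x0)
  then have "snd (snd (jet1_coords (b, c) j)) = z"
    by (simp add: jet1_coords_def Let_def fst_j x0 vec_eq_iff matrix_vector_mult_def axis_def if_distrib cong: if_cong)
  then have "jet1_coords (b, c) j = p"
    using jet1_coords_fst(1,2)[OF j tc(1)] by (simp add: pe prod_eq_iff tc(2))
  moreover have "j \<in> jet1_domain X Y \<pi> (b, c)" using j tc(1) by (simp add: jet1_domain_def)
  ultimately show "p \<in> J" by blast
qed

lemma open_J: "open J"
proof -
  have "continuous_on UNIV (\<lambda>p :: ('n, 'm) jcoord. (fst p, fst (snd p)))"
    by (intro continuous_intros)
  from open_vimage[OF image_of_open[OF c_is_chart] this] show ?thesis
    unfolding J_eq by (simp add: vimage_def)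
qed

text \<open>The components are second partial derivatives of a representing section, so they commute
  once this section is smooth in the chart. That its value lies in \<open>fst c\<close> follows from
  the projection of \<Gamma> j being j.\<close>

lemma soc_components_sym:
  assumes \<Gamma>: "second_order_connection X Y \<pi> \<Gamma>" and p: "p \<in> J"
  shows "soc_components X Y \<pi> \<Gamma> (b, c) p $ \<sigma> $ i $ k = soc_components X Y \<pi> \<Gamma> (b, c) p $ \<sigma> $ k $ i"
proof -
  define j where "j = inv_into (jet1_domain X Y \<pi> (b, c)) (jet1_coords (b, c)) p"
  have "j \<in> jet1_domain X Y \<pi> (b, c)" using p by (simp add: j_def inv_into_into)
  then have j: "j \<in> jets X Y \<pi> 1" "target j \<in> fst c" by (auto simp: jet1_domain_def)
  define j2 where "j2 = \<Gamma> j"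
  have j2: "j2 \<in> jets X Y \<pi> 2" and proj: "jet X Y \<pi> 1 (fst j2) (representative j2) = j"
    using \<Gamma> j(1) by (auto simp: second_order_connection_def jet_proj_def j2_def)
  define r where "r = representative j2"
  define x where "x = fst j2"
  have r: "local_section X Y \<pi> x r"
    using local_section_representative[OF j2] by (simp add: r_def x_def)
  have fst_j: "fst j = x" using proj by (auto simp: jet_def x_def)
  have "same_jet X Y 1 x r (representative j)"
    using representative_mem[OF j(1)] unfolding proj[symmetric] by (simp add: jet_def r_def x_def)
  then have rx: "r x = target j" by (simp add: target_def same_jet_def fst_j)
  have xb: "x \<in> fst b" using jet1_coords_fst(3)[OF j] fst_j by simp
  obtain D where D: "open D" "snd b x \<in> D" "Ck_on 2 D (coord_rep b c r)"
    using local_section_smooth[OF r xb] rx j(2) by metis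
  have "Ck_on 2 D (fibre_rep (b, c) j2)"
    using Ck_on_bounded_linear[OF bounded_linear_snd D(1,3)] by (simp add: fibre_rep_def[abs_def] r_def)
  from symmetric_second_derivative[OF D(1,2) this]
  have "partials [i, k] (fibre_rep (b, c) j2) (snd b x) = partials [k, i] (fibre_rep (b, c) j2) (snd b x)"
    by (simp add: partial_def[abs_def])
  then show ?thesis
    by (simp add: soc_components_def jet2_second_coords_def j_def[symmetric] j2_def[symmetric] x_def)
qed

lemma embedded_chart_of_connection:
  assumes \<Gamma>: "second_order_connection X Y \<pi> \<Gamma>"
    and \<phi>: "one_form X \<phi>" and v: "vector_field X v" and unit: "unit_pairing X \<phi> v"
    and Z: "local_connection X Y \<pi> V Z" and emb: "embedded_connection X Y \<pi> \<Gamma> V Z"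
  shows "embedded_chart J (image_of b) (soc_components X Y \<pi> \<Gamma> (b, c)) (\<phi> b) (v b)
    (snd c ` (fst c \<inter> V)) (connection_rep (b, c) Z)"
proof
  show "open J" by (rule open_J)
  show "open (image_of b)" by (rule image_of_open[OF b_is_chart])
  show "fst p \<in> image_of b" if "p \<in> J" for p
    using that fst_image_of_c unfolding J_eq by fastforce
  show "Ck_on 2 J (soc_components X Y \<pi> \<Gamma> (b, c))"
    using \<Gamma> bc by (auto simp: second_order_connection_def intro: Ck_on_of_smooth_on)
  show "Ck_on 2 (image_of b) (\<phi> b)" "Ck_on 2 (image_of b) (v b)"
    using \<phi> v b_chart by (auto simp: one_form_def vector_field_def intro: Ck_on_of_smooth_on)
  show "\<phi> b x \<bullet> v b x = 1" if "x \<in> image_of b" for x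
    using unit b_chart that by (auto simp: unit_pairing_def)
  show "soc_components X Y \<pi> \<Gamma> (b, c) p $ \<sigma> $ i $ k = soc_components X Y \<pi> \<Gamma> (b, c) p $ \<sigma> $ k $ i"
    if "p \<in> J" for p \<sigma> i k
    by (rule soc_components_sym[OF \<Gamma> that])
  have Zy: "Z y \<in> jets X Y \<pi> 1 \<and> target (Z y) = y" if "y \<in> V" for y
    using Z that by (auto simp: local_connection_def)
  have V: "openin (mtop Y) V" and Zs: "smooth_on (snd c ` (fst c \<inter> V)) (connection_rep (b, c) Z)"
    using Z bc by (auto simp: local_connection_def)
  show "open (snd c ` (fst c \<inter> V))" by (rule open_chart_image[OF c_is_chart V])
  show "Ck_on 2 (snd c ` (fst c \<inter> V)) (connection_rep (b, c) Z)" by (rule Ck_on_of_smooth_on[OF Zs])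
  fix \<eta> assume "\<eta> \<in> snd c ` (fst c \<inter> V)"
  then obtain y where y: "y \<in> fst c" "y \<in> V" "\<eta> = snd c y" by auto
  have rep: "connection_rep (b, c) Z \<eta> = jet1_coords (b, c) (Z y)"
    by (simp add: connection_rep_def y inv_chart_left[OF c_is_chart])
  show "connection_rep (b, c) Z \<eta> \<in> J"
    unfolding rep using Zy[OF y(2)] y(1) by (auto simp: jet1_domain_def)
  show "fst (connection_rep (b, c) Z \<eta>) = fst \<eta>" "fst (snd (connection_rep (b, c) Z \<eta>)) = snd \<eta>"
    unfolding rep using jet1_coords_fst(1,2)[of "Z y" 1] Zy[OF y(2)] y by auto
  show "frechet_derivative (connection_rep (b, c) Z) (at \<eta>) ` D_Z (connection_rep (b, c) Z) \<eta>
      \<subseteq> D_Gamma (soc_components X Y \<pi> \<Gamma> (b, c)) (connection_rep (b, c) Z \<eta>)"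
    using emb bc y unfolding embedded_connection_def Let_def by fastforce
qed

end

section \<open>The identity on the manifold, chart by chart\<close>

theorem theorem3p2p5:
  fixes X :: "('x, real^'n) manifold"
    and Y :: "('y, (real^'n) \<times> (real^'m)) manifold"
    and \<pi> :: "'y \<Rightarrow> 'x"
    and \<Gamma> :: "('x, 'y) jet \<Rightarrow> ('x, 'y) jet"
    and \<phi> v :: "('x, real^'n) chart \<Rightarrow> real^'n \<Rightarrow> real^'n"
    and V :: "'y set"
    and Z :: "'y \<Rightarrow> ('x, 'y) jet"
  assumes "CARD('n) > 1"
    and "fibred_manifold X Y \<pi>"
    and "second_order_connection X Y \<pi> \<Gamma>"
    and "one_form X \<phi>" and "closed_form X \<phi>" and "nonvanishing_form X \<phi>"
    and "vector_field X v" and "unit_pairing X \<phi> v"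
    and "local_connection X Y \<pi> V Z"
    and "embedded_connection X Y \<pi> \<Gamma> V Z"
  shows "vforms_equal X Y \<pi> V
    (\<lambda>C. lie_vform 1 (horizontal_lift Z v C) (shape_operator X Y \<pi> \<Gamma> \<phi> v Z C))
    (\<lambda>C \<eta> w.
       - comp_vform (shape_operator X Y \<pi> \<Gamma> \<phi> v Z C) (shape_operator X Y \<pi> \<Gamma> \<phi> v Z C) \<eta> w
       - contract_vform (horizontal_lift Z v C)
           (\<lambda>\<eta> w. Z_phi_Phi_plus X Y \<pi> \<Gamma> \<phi> v Z C \<eta> w + Z_phi_r_plus X Y \<pi> \<Gamma> \<phi> v Z C \<eta> w) \<eta> w)"
  unfolding vforms_equal_def
proof (intro ballI allI)
  fix C y and w :: "nat \<Rightarrow> ('n, 'm) ycoord"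
  assume C: "C \<in> fibred_charts X Y \<pi>" and y: "y \<in> fst (snd C) \<inter> V"
  obtain b c where Cbc: "C = (b, c)" by (cases C)
  interpret manifold_chart X Y \<pi> b c
    using assms(2) C Cbc by unfold_locales auto
  interpret embedded_chart J "image_of b" "soc_components X Y \<pi> \<Gamma> (b, c)" "\<phi> b" "v b"
    "snd c ` (fst c \<inter> V)" "connection_rep (b, c) Z"
    by (rule embedded_chart_of_connection[OF assms(3,4,7,8,9,10)])
  have "snd c y \<in> snd c ` (fst c \<inter> V)" using y unfolding Cbc by auto
  from lie_shape_operator[OF this, of w]
  show "lie_vform 1 (horizontal_lift Z v C) (shape_operator X Y \<pi> \<Gamma> \<phi> v Z C) (snd (snd C) y) w =
     - comp_vform (shape_operator X Y \<pi> \<Gamma> \<phi> v Z C) (shape_operator X Y \<pi> \<Gamma> \<phi> v Z C) (snd (snd C) y) w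
       - contract_vform (horizontal_lift Z v C)
           (\<lambda>\<eta> w. Z_phi_Phi_plus X Y \<pi> \<Gamma> \<phi> v Z C \<eta> w + Z_phi_r_plus X Y \<pi> \<Gamma> \<phi> v Z C \<eta> w) (snd (snd C) y) w"
    unfolding Cbc horizontal_lift_def shape_operator_def Z_phi_Phi_plus_def Z_phi_r_plus_def fst_conv snd_conv .
qed

end
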